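(* The inclusion relation on polynomial time sets is complete for $\Pi^0_1$ preorders. That is, taking $X_i$ to mean the $i$th polynomial time set, the relation $\{(i,j):X_i\subseteq X_j\}$ is a $\Pi^0_1$ preorder on $\mathbb{N}$, and for every $\Pi^0_1$ preorder $P$ on $\mathbb{N}$ there exists a computable $f:\mathbb{N}\to\mathbb{N}$ such that for all $x,y\in\mathbb{N}$: $$(x,y)\in P\iff X_{f(x)}\subseteq X_{f(y)}.$$
   Context: $(X_i)_{i\in\mathbb{N}}$ is a standard effective enumeration of all polynomial time decidable sets of binary strings, e.g. by Turing machines with polynomial clocks, so that $X_i$ is decidable uniformly in $i$. A preorder is a reflexive transitive relation; a $\Pi^0_1$ preorder is one whose complement in $\mathbb{N}^2$ is recursively enumerable. Completeness is with respect to computable component-wise reducibility: $R\le S$ iff there is a computable $f:\mathbb{N}\to\mathbb{N}$ with $(x,y)\in R\iff(f(x),f(y))\in S$ for all $x,y$. *)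

theory Defs
  imports "HOL-Library.Nat_Bijection" "HOL-Computational_Algebra.Polynomial"
begin

section \<open>Recursive functions and recursively enumerable sets\<close>

text \<open>
  \<open>recursive n F\<close>: the restriction of \<open>F\<close> to lists of length \<open>n\<close> is an \<open>n\<close>-ary total recursive
  function.  Values of \<open>F\<close> on lists of any other length carry no meaning.  Minimisation is applied
  only to functions that have a zero for every choice of parameters, so every member of the class
  is total; this yields exactly the total computable functions.
\<close>

inductive recursive :: "nat \<Rightarrow> (nat list \<Rightarrow> nat) \<Rightarrow> bool" where
  zero: "recursive n (\<lambda>xs. 0)"
| succ: "recursive 1 (\<lambda>xs. Suc (xs ! 0))"
| proj: "i < n \<Longrightarrow> recursive n (\<lambda>xs. xs ! i)"
| comp: "recursive m f \<Longrightarrow> length gs = m \<Longrightarrow> \<forall>g\<in>set gs. recursive n g \<Longrightarrow>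
    recursive n (\<lambda>xs. f (map (\<lambda>g. g xs) gs))"
| prim_rec: "recursive n f \<Longrightarrow> recursive (Suc (Suc n)) g \<Longrightarrow>
    recursive (Suc n) (\<lambda>xs. rec_nat (f (tl xs)) (\<lambda>k r. g (k # r # tl xs)) (hd xs))"
| minimise: "recursive (Suc n) f \<Longrightarrow> \<forall>xs. length xs = n \<longrightarrow> (\<exists>y. f (y # xs) = 0) \<Longrightarrow>
    recursive n (\<lambda>xs. LEAST y. f (y # xs) = 0)"

definition computable :: "(nat \<Rightarrow> nat) \<Rightarrow> bool" where
  "computable f \<longleftrightarrow> (\<exists>F. recursive 1 F \<and> (\<forall>x. f x = F [x]))"

definition rec_enumerable :: "nat set \<Rightarrow> bool" where
  "rec_enumerable A \<longleftrightarrow> A = {} \<or> (\<exists>f. computable f \<and> A = range f)"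

text \<open>Binary relations are viewed as sets of numbers through Cantor pairing.\<close>

definition Pi01 :: "(nat \<times> nat) set \<Rightarrow> bool" where
  "Pi01 R \<longleftrightarrow> rec_enumerable (prod_encode ` (- R))"

definition Pi01_preorder :: "(nat \<times> nat) set \<Rightarrow> bool" where
  "Pi01_preorder R \<longleftrightarrow> preorder_on UNIV R \<and> Pi01 R"


section \<open>Multi-tape Turing machines\<close>

text \<open>
  Tape symbols are natural numbers: \<open>0\<close> is the blank, \<open>1\<close> and \<open>2\<close> are the two input symbols, all
  others are auxiliary.  A two-way infinite tape is a pair \<open>(l, r)\<close>: \<open>r\<close> starts with the scanned
  cell and continues to the right, \<open>l\<close> lists the cells to the left of the head, nearest first, and
  all cells not listed are blank.
\<close>

type_synonym tape = "nat list \<times> nat list"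

datatype move = MoveLeft | MoveRight | Stay

definition first_cell :: "nat list \<Rightarrow> nat" where
  "first_cell cs = (case cs of [] \<Rightarrow> 0 | a # _ \<Rightarrow> a)"

definition scan :: "tape \<Rightarrow> nat" where
  "scan t = first_cell (snd t)"

definition put :: "nat \<Rightarrow> tape \<Rightarrow> tape" where
  "put a t = (fst t, a # tl (snd t))"

fun move_head :: "move \<Rightarrow> tape \<Rightarrow> tape" where
  "move_head MoveLeft (l, r) = (tl l, first_cell l # r)"
| "move_head MoveRight (l, r) = (first_cell r # l, tl r)"
| "move_head Stay t = t"

text \<open>
  An instruction \<open>(q, as, q')\<close> has one entry \<open>(a, b, d)\<close> of \<open>as\<close> for each tape: it applies in state
  \<open>q\<close> if every tape scans its \<open>a\<close>, then writes the \<open>b\<close>s, moves the heads according to the \<open>d\<close>s and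
  enters state \<open>q'\<close>.  A machine consists of its number of tapes other than the input tape and a
  finite list of instructions, the first applicable one being executed.  An instruction whose
  number of entries differs from the number of tapes never applies.
\<close>

type_synonym instr = "nat \<times> (nat \<times> nat \<times> move) list \<times> nat"
type_synonym machine = "nat \<times> instr list"
type_synonym config = "nat \<times> tape list"

definition start_state :: nat where "start_state = 0"
definition accept_state :: nat where "accept_state = 1"

definition applicable :: "machine \<Rightarrow> config \<Rightarrow> instr option" where
  "applicable M c = (if fst c = accept_state then None
     else find (\<lambda>(q, as, q'). q = fst c \<and> map fst as = map scan (snd c)) (snd M))"

definition halted :: "machine \<Rightarrow> config \<Rightarrow> bool" where
  "halted M c \<longleftrightarrow> applicable M c = None"

definition step :: "machine \<Rightarrow> config \<Rightarrow> config" where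
  "step M c = (case applicable M c of
     None \<Rightarrow> c
   | Some (q, as, q') \<Rightarrow> (q', map2 (\<lambda>(a, b, d) t. move_head d (put b t)) as (snd c)))"

definition start_config :: "machine \<Rightarrow> bool list \<Rightarrow> config" where
  "start_config M w =
     (start_state, ([], map (\<lambda>b. if b then 2 else 1) w) # replicate (fst M) ([], []))"

definition run :: "machine \<Rightarrow> bool list \<Rightarrow> nat \<Rightarrow> config" where
  "run M w t = (step M ^^ t) (start_config M w)"

text \<open>Halted configurations are fixed points of \<open>step\<close>, so this means ``in at most \<open>t\<close> steps''.\<close>

definition accepts_within :: "machine \<Rightarrow> bool list \<Rightarrow> nat \<Rightarrow> bool" where
  "accepts_within M w t \<longleftrightarrow> fst (run M w t) = accept_state"


section \<open>The enumeration of polynomial time sets\<close>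

text \<open>
  The following decoding maps are surjective.  The \<open>(e, c)\<close>-th set is given by the \<open>e\<close>-th machine,
  with a clock that rejects an input \<open>w\<close> not accepted within \<open>|w|^c + c\<close> steps.
  Conversely to the last lemma of this theory, each enumerated set is polynomial time decidable,
  because a machine can count these steps on additional tapes.
\<close>

definition move_decode :: "nat \<Rightarrow> move" where
  "move_decode d = (if d = 0 then MoveLeft else if d = 1 then MoveRight else Stay)"

definition action_decode :: "nat \<Rightarrow> nat \<times> nat \<times> move" where
  "action_decode n = (case prod_decode n of (a, m) \<Rightarrow>
     (case prod_decode m of (b, d) \<Rightarrow> (a, b, move_decode d)))"

definition instr_decode :: "nat \<Rightarrow> instr" where
  "instr_decode n = (case prod_decode n of (q, m) \<Rightarrow>
     (case prod_decode m of (as, q') \<Rightarrow> (q, map action_decode (list_decode as), q')))"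

definition machine_decode :: "nat \<Rightarrow> machine" where
  "machine_decode n = (case prod_decode n of (k, p) \<Rightarrow> (k, map instr_decode (list_decode p)))"

definition ptime_set :: "nat \<Rightarrow> bool list set" where
  "ptime_set i = (case prod_decode i of (e, c) \<Rightarrow>
     {w. accepts_within (machine_decode e) w (length w ^ c + c)})"


section \<open>Every set decidable in polynomial time is enumerated\<close>

definition poly_time_decidable :: "bool list set \<Rightarrow> bool" where
  "poly_time_decidable L \<longleftrightarrow> (\<exists>M. \<exists>p :: nat poly. \<forall>w.
     halted M (run M w (poly p (length w))) \<and>
     (w \<in> L \<longleftrightarrow> accepts_within M w (poly p (length w))))"

lemma surj_map: "surj f \<Longrightarrow> \<exists>ys. xs = map f ys"
  by (metis ex_map_conv surjD)

lemma surj_move_decode: "surj move_decode"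
proof (rule surjI)
  fix d
  show "move_decode (case d of MoveLeft \<Rightarrow> 0 | MoveRight \<Rightarrow> 1 | Stay \<Rightarrow> 2) = d"
    by (cases d) (auto simp: move_decode_def)
qed

lemma surj_action_decode: "surj action_decode"
  unfolding surj_def
proof (intro allI)
  fix y :: "nat \<times> nat \<times> move"
  obtain a b d where y: "y = (a, b, d)" by (cases y)
  obtain k where "d = move_decode k" using surj_move_decode by (metis surjD)
  then have "y = action_decode (prod_encode (a, prod_encode (b, k)))"
    by (simp add: y action_decode_def)
  then show "\<exists>x. y = action_decode x" ..
qed

lemma surj_instr_decode: "surj instr_decode"
  unfolding surj_def
proof (intro allI)
  fix y :: instr
  obtain q as q' where y: "y = (q, as, q')" by (cases y)
  obtain ks where "as = map action_decode ks" using surj_map[OF surj_action_decode] by blast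
  then have "y = instr_decode (prod_encode (q, prod_encode (list_encode ks, q')))"
    by (simp add: y instr_decode_def)
  then show "\<exists>x. y = instr_decode x" ..
qed

lemma surj_machine_decode: "surj machine_decode"
  unfolding surj_def
proof (intro allI)
  fix y :: machine
  obtain k ins where y: "y = (k, ins)" by (cases y)
  obtain ks where "ins = map instr_decode ks" using surj_map[OF surj_instr_decode] by blast
  then have "y = machine_decode (prod_encode (k, list_encode ks))"
    by (simp add: y machine_decode_def)
  then show "\<exists>x. y = machine_decode x" ..
qed

lemma poly_le_clock:
  fixes p :: "nat poly"
  shows "\<exists>c. \<forall>n. poly p n \<le> n ^ c + c"
proof (intro exI allI)
  fix n :: nat
  define s where "s = poly p 1"
  have s: "s = (\<Sum>i\<le>degree p. coeff p i)" by (simp add: s_def poly_altdef)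
  consider "n = 0" | "n = 1" | "n \<ge> 2" by linarith
  then show "poly p n \<le> n ^ (degree p + poly p 1) + (degree p + poly p 1)"
  proof cases
    case 1
    have "coeff p 0 \<le> s" unfolding s by (rule member_le_sum) auto
    then show ?thesis using 1 by (simp add: poly_0_coeff_0 s_def)
  next
    case 2
    then show ?thesis by simp
  next
    case 3
    have "poly p n \<le> (\<Sum>i\<le>degree p. coeff p i * n ^ degree p)"
      unfolding poly_altdef using 3 by (intro sum_mono mult_left_mono power_increasing) auto
    also have "\<dots> = s * n ^ degree p" by (simp add: s sum_distrib_right)
    also have "\<dots> \<le> n ^ s * n ^ degree p"
    proof (rule mult_right_mono)
      have "s \<le> 2 ^ s" by (simp add: less_imp_le)
      also have "\<dots> \<le> n ^ s" using 3 by (intro power_mono) auto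
      finally show "s \<le> n ^ s" .
    qed simp
    also have "\<dots> = n ^ (degree p + poly p 1)" by (simp add: s_def power_add mult.commute)
    finally show ?thesis by simp
  qed
qed

lemma run_halted:
  assumes "halted M (run M w s)" and "s \<le> t"
  shows "run M w t = run M w s"
  using assms(2)
proof (induction t rule: dec_induct)
  case (step t)
  have "run M w (Suc t) = step M (run M w t)" by (simp add: run_def)
  with step.IH assms(1) show ?case by (simp add: step_def halted_def)
qed simp

lemma poly_time_decidable_enumerated:
  assumes "poly_time_decidable L"
  shows "\<exists>i. L = ptime_set i"
proof -
  obtain M and p :: "nat poly" where
    h: "\<And>w. halted M (run M w (poly p (length w)))" and
    L: "\<And>w. w \<in> L \<longleftrightarrow> accepts_within M w (poly p (length w))"
    using assms unfolding poly_time_decidable_def by blast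
  obtain c where c: "\<And>n. poly p n \<le> n ^ c + c" using poly_le_clock by blast
  obtain e where e: "M = machine_decode e" using surj_machine_decode by (metis surjD)
  have "L = ptime_set (prod_encode (e, c))"
    using L run_halted[OF h c] by (auto simp: ptime_set_def accepts_within_def e)
  then show ?thesis ..
qed

end

theory Submission
  imports Defs
begin

text \<open>
  Membership in \<open>ptime_set i\<close> is decidable uniformly in \<open>i\<close>, so non-inclusion is recursively
  enumerable.

  For hardness, let \<open>P\<close> be a \<open>\<Pi>\<^sup>0\<^sub>1\<close> preorder and let \<open>(a\<^sub>s, b\<^sub>s)\<close> enumerate its complement.  For each
  \<open>s\<close> there is, uniformly in \<open>s\<close>, a decidable upward closed set \<open>U\<^sub>s\<close> that contains \<open>a\<^sub>s\<close> but not
  \<open>b\<^sub>s\<close>: the numbers \<open>0, 1, 2, \<dots>\<close> are decided one after the other, each time waiting until the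
  enumeration confirms that one of the two answers is safe.  Hence \<open>(x, y) \<in> P\<close> iff
  \<open>{s. x \<in> U\<^sub>s} \<subseteq> {s. y \<in> U\<^sub>s}\<close>.

  To turn these decidable sets into polynomial time sets preserving inclusion, replace \<open>s\<close> by all words
  consisting of \<open>s\<close> in unary followed by a padding whose length is at least \<open>m s\<close>, where the bound
  \<open>m s\<close> does not depend on \<open>x\<close> and dominates the time needed to decide \<open>x \<in> U\<^sub>s\<close> for all \<open>x \<le> s\<close>.
  Taking \<open>m s\<close> to be the running time of a fixed program, the bound is checked by letting this program
  run while the input head moves along the padding.
\<close>

section \<open>Recursive functions\<close>

text \<open>One threshold cannot in general dominate the decision time for all \<open>x\<close> at
  once; hence it serves \<open>x \<le> s\<close> only, and for fixed \<open>x\<close> the finitely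
  many remaining \<open>s\<close> are paid for by the constant of the clock. Since the clock cuts
  off acceptance, termination alone is not enough and running times must be known. Counter programs
  are therefore given a cost equal to the number of machine steps after compilation. No program is
  analysed for its running time: the time exists because the program terminates, and it is
  computable because simulating a compiled machine and searching for its acceptance time is
  computable. The simulation that makes non-inclusion enumerable thus also serves the hardness
  proof.\<close>

text \<open>Values on lists of length other than \<open>n\<close> are irrelevant, so recursiveness is taken up to
  changing them.\<close>

definition rec_fun :: "nat \<Rightarrow> (nat list \<Rightarrow> nat) \<Rightarrow> bool" where
  "rec_fun n F \<longleftrightarrow> (\<exists>G. recursive n G \<and> (\<forall>xs. length xs = n \<longrightarrow> F xs = G xs))"

lemma rec_fun_cong:
  "rec_fun n G \<Longrightarrow> (\<And>xs. length xs = n \<Longrightarrow> F xs = G xs) \<Longrightarrow> rec_fun n F"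
  unfolding rec_fun_def by metis

lemma rec_fun_recursive: "recursive n F \<Longrightarrow> rec_fun n F"
  unfolding rec_fun_def by blast

lemma rec_fun_nth: "i < n \<Longrightarrow> rec_fun n (\<lambda>xs. xs ! i)"
  by (intro rec_fun_recursive recursive.proj)

lemma rec_fun_comp:
  assumes "rec_fun m F" "length gs = m" "\<And>g. g \<in> set gs \<Longrightarrow> rec_fun n g"
  shows "rec_fun n (\<lambda>xs. F (map (\<lambda>g. g xs) gs))"
proof -
  obtain F' where F': "recursive m F'" "\<And>xs. length xs = m \<Longrightarrow> F xs = F' xs"
    using assms(1) unfolding rec_fun_def by blast
  have "\<forall>g. \<exists>g'. g \<in> set gs \<longrightarrow> recursive n g' \<and> (\<forall>xs. length xs = n \<longrightarrow> g xs = g' xs)"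
    using assms(3) unfolding rec_fun_def by blast
  then obtain T where T: "\<And>g. g \<in> set gs \<Longrightarrow> recursive n (T g)"
    "\<And>g xs. g \<in> set gs \<Longrightarrow> length xs = n \<Longrightarrow> g xs = T g xs" by metis
  have "recursive n (\<lambda>xs. F' (map (\<lambda>g. g xs) (map T gs)))"
    using F'(1) assms(2) T(1) by (intro recursive.comp) auto
  moreover have "F (map (\<lambda>g. g xs) gs) = F' (map (\<lambda>g. g xs) (map T gs))" if "length xs = n" for xs
  proof -
    have "map (\<lambda>g. g xs) gs = map (\<lambda>g. g xs) (map T gs)" using T(2) that by simp
    then show ?thesis using F'(2)[of "map (\<lambda>g. g xs) gs"] assms(2) by (metis length_map)
  qed
  ultimately show ?thesis unfolding rec_fun_def by blast
qed

lemma rec_fun_comp1: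
  assumes "rec_fun 1 F" "rec_fun n a"
  shows "rec_fun n (\<lambda>xs. F [a xs])"
  using rec_fun_comp[of 1 F "[a]" n] assms by simp

lemma rec_fun_comp2:
  assumes "rec_fun 2 F" "rec_fun n a" "rec_fun n b"
  shows "rec_fun n (\<lambda>xs. F [a xs, b xs])"
  using rec_fun_comp[of 2 F "[a, b]" n] assms by auto

lemma rec_fun_Suc: "rec_fun n a \<Longrightarrow> rec_fun n (\<lambda>xs. Suc (a xs))"
  using rec_fun_comp1[OF rec_fun_recursive[OF recursive.succ]] by simp

lemma rec_fun_const: "rec_fun n (\<lambda>xs. k)"
  by (induction k) (auto intro: rec_fun_Suc rec_fun_recursive recursive.zero)

lemma rec_fun_rec_nat:
  assumes "rec_fun n a" "rec_fun (Suc (Suc n)) (\<lambda>ys. g (ys ! 0) (ys ! 1) (tl (tl ys)))" "rec_fun n m"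
  shows "rec_fun n (\<lambda>xs. rec_nat (a xs) (\<lambda>k r. g k r xs) (m xs))"
proof -
  obtain a' where a': "recursive n a'" "\<And>xs. length xs = n \<Longrightarrow> a xs = a' xs"
    using assms(1) unfolding rec_fun_def by blast
  obtain g' where g': "recursive (Suc (Suc n)) g'"
    "\<And>ys. length ys = Suc (Suc n) \<Longrightarrow> g (ys ! 0) (ys ! 1) (tl (tl ys)) = g' ys"
    using assms(2) unfolding rec_fun_def by blast
  let ?R = "\<lambda>xs. rec_nat (a' (tl xs)) (\<lambda>k r. g' (k # r # tl xs)) (hd xs)"
  have R: "rec_fun (Suc n) ?R"
    using recursive.prim_rec[OF a'(1) g'(1)] by (rule rec_fun_recursive)
  \<comment> \<open>\<open>prim_rec\<close> recurses on the head of its argument list, so the list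
    is rebuilt from projections with the recursion bound \<open>m xs\<close> in front.\<close>
  have "rec_fun n (\<lambda>xs. ?R (map (\<lambda>g. g xs) (m # map (\<lambda>i xs. xs ! i) [0..<n])))"
    using assms(3) by (intro rec_fun_comp[OF R]) (auto intro: rec_fun_nth)
  moreover have "rec_nat (a xs) (\<lambda>k r. g k r xs) (m xs) =
      ?R (map (\<lambda>g. g xs) (m # map (\<lambda>i xs. xs ! i) [0..<n]))" if "length xs = n" for xs
  proof -
    have "map ((\<lambda>g. g xs) \<circ> (\<lambda>i xs. xs ! i)) [0..<n] = xs"
      using that by (auto simp: comp_def intro!: nth_equalityI)
    moreover have "g k r xs = g' (k # r # xs)" for k r
      using g'(2)[of "k # r # xs"] that by simp
    ultimately show ?thesis using a'(2)[OF that] by simp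
  qed
  ultimately show ?thesis by (rule rec_fun_cong) simp
qed

lemma rec_fun_Least:
  assumes "rec_fun (Suc n) f" "\<And>xs. length xs = n \<Longrightarrow> \<exists>y. f (y # xs) = 0"
  shows "rec_fun n (\<lambda>xs. LEAST y. f (y # xs) = 0)"
proof -
  obtain f' where f': "recursive (Suc n) f'" "\<And>xs. length xs = Suc n \<Longrightarrow> f xs = f' xs"
    using assms(1) unfolding rec_fun_def by blast
  have e: "f (y # xs) = f' (y # xs)" if "length xs = n" for xs y
    using f'(2)[of "y # xs"] that by simp
  have "recursive n (\<lambda>xs. LEAST y. f' (y # xs) = 0)"
    using assms(2) e by (intro recursive.minimise[OF f'(1)]) auto
  then show ?thesis unfolding rec_fun_def using e by (intro exI conjI) auto
qed

lemma computable_iff_rec_fun: "computable f \<longleftrightarrow> rec_fun 1 (\<lambda>xs. f (xs ! 0))"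
proof
  assume "computable f"
  then obtain F where "recursive 1 F" "\<And>x. f x = F [x]" unfolding computable_def by blast
  then show "rec_fun 1 (\<lambda>xs. f (xs ! 0))"
    unfolding rec_fun_def by (auto intro!: exI[of _ F] simp: length_Suc_conv)
next
  assume "rec_fun 1 (\<lambda>xs. f (xs ! 0))"
  then obtain G where "recursive 1 G" "\<And>xs. length xs = 1 \<Longrightarrow> f (xs ! 0) = G xs"
    unfolding rec_fun_def by blast
  then show "computable f" unfolding computable_def by (intro exI[of _ G]) (metis length_Cons list.size(3) nth_Cons_0 One_nat_def)
qed

lemma rec_fun_computable:
  assumes "computable f" "rec_fun n a"
  shows "rec_fun n (\<lambda>xs. f (a xs))"
  using rec_fun_comp1[OF assms(1)[unfolded computable_iff_rec_fun] assms(2)] by simp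

lemma computable_Least:
  assumes "rec_fun 2 (\<lambda>xs. f (xs ! 0) (xs ! 1))" "\<And>x. \<exists>y. f y x = 0"
  shows "computable (\<lambda>x. LEAST y. f y x = 0)"
proof -
  have "rec_fun 1 (\<lambda>xs. LEAST y. (\<lambda>zs. f (zs ! 0) (zs ! 1)) (y # xs) = 0)"
    using assms by (intro rec_fun_Least) (auto simp: numeral_2_eq_2)
  then show ?thesis unfolding computable_iff_rec_fun by simp
qed

lemma rec_fun_op2: "rec_fun n a \<Longrightarrow> rec_fun n b \<Longrightarrow> rec_fun 2 (\<lambda>xs. h (xs ! 0) (xs ! 1)) \<Longrightarrow>
  rec_fun n (\<lambda>xs. h (a xs) (b xs))"
  using rec_fun_comp2[of "\<lambda>xs. h (xs ! 0) (xs ! 1)"] by simp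

section \<open>Arithmetic, case distinction and Cantor pairing\<close>

lemma rec_fun_add:
  assumes "rec_fun n a" "rec_fun n b"
  shows "rec_fun n (\<lambda>xs. a xs + b xs)"
proof -
  have "rec_fun 2 (\<lambda>xs. rec_nat (xs ! 0) (\<lambda>k r. Suc r) (xs ! 1))"
    by (intro rec_fun_rec_nat rec_fun_Suc rec_fun_nth) auto
  moreover have "rec_nat u (\<lambda>k r. Suc r) v = u + v" for u v :: nat by (induction v) auto
  ultimately show ?thesis using rec_fun_op2[OF assms] by simp
qed

lemma rec_fun_mult:
  assumes "rec_fun n a" "rec_fun n b"
  shows "rec_fun n (\<lambda>xs. a xs * b xs)"
proof -
  have "rec_fun 2 (\<lambda>xs. rec_nat 0 (\<lambda>k r. r + xs ! 0) (xs ! 1))"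
    by (intro rec_fun_rec_nat rec_fun_const rec_fun_add rec_fun_nth)
       (auto simp: nth_tl numeral_2_eq_2 intro!: rec_fun_cong[OF rec_fun_nth[of 2]])
  moreover have "rec_nat 0 (\<lambda>k r. r + u) v = u * v" for u v :: nat by (induction v) auto
  ultimately show ?thesis using rec_fun_op2[OF assms] by simp
qed

lemma rec_fun_diff:
  assumes "rec_fun n a" "rec_fun n b"
  shows "rec_fun n (\<lambda>xs. a xs - b xs)"
proof -
  have "rec_fun 1 (\<lambda>xs. rec_nat 0 (\<lambda>k r. k) (xs ! 0))"
    by (intro rec_fun_rec_nat rec_fun_const rec_fun_nth) auto
  moreover have "rec_nat 0 (\<lambda>k r. k) u = u - 1" for u :: nat by (cases u) auto
  ultimately have p: "rec_fun 1 (\<lambda>xs. xs ! 0 - 1)" by simp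
  have "rec_fun 2 (\<lambda>xs. rec_nat (xs ! 0) (\<lambda>k r. r - 1) (xs ! 1))"
    using rec_fun_comp1[OF p]
    by (intro rec_fun_rec_nat rec_fun_const rec_fun_nth) (auto simp: rec_fun_nth)
  moreover have "rec_nat u (\<lambda>k r. r - 1) v = u - v" for u v :: nat by (induction v) auto
  ultimately show ?thesis using rec_fun_op2[OF assms] by simp
qed

text \<open>With truncated subtraction \<open>1 - c xs\<close> is the indicator of
  \<open>c xs = 0\<close>, which turns the case distinction into a sum of two products.\<close>

lemma rec_fun_if0:
  assumes "rec_fun n c" "rec_fun n a" "rec_fun n b"
  shows "rec_fun n (\<lambda>xs. if c xs = 0 then a xs else b xs)"
proof -
  have "rec_fun n (\<lambda>xs. (1 - c xs) * a xs + (1 - (1 - c xs)) * b xs)"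
    by (intro rec_fun_add rec_fun_mult rec_fun_diff rec_fun_const assms)
  then show ?thesis by (rule rec_fun_cong) auto
qed

lemma rec_fun_triangle: "rec_fun n a \<Longrightarrow> rec_fun n (\<lambda>xs. triangle (a xs))"
proof -
  have "rec_fun 1 (\<lambda>xs. rec_nat 0 (\<lambda>k r. r + Suc k) (xs ! 0))"
    by (intro rec_fun_rec_nat rec_fun_const rec_fun_add rec_fun_Suc rec_fun_nth) auto
  moreover have "rec_nat 0 (\<lambda>k r. r + Suc k) u = triangle u" for u :: nat by (induction u) auto
  ultimately have "rec_fun 1 (\<lambda>xs. triangle (xs ! 0))" by simp
  from rec_fun_comp1[OF this] show "rec_fun n a \<Longrightarrow> rec_fun n (\<lambda>xs. triangle (a xs))" by simp
qed

lemma rec_fun_prod_encode: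
  "rec_fun n a \<Longrightarrow> rec_fun n b \<Longrightarrow> rec_fun n (\<lambda>xs. prod_encode (a xs, b xs))"
  unfolding prod_encode_def by (simp add: rec_fun_add rec_fun_triangle)

text \<open>The largest \<open>k\<close> with \<open>triangle k \<le> n\<close>; it grows by at most
  one when \<open>n\<close> does, so primitive recursion finds it. On the Cantor code of
  \<open>(a, b)\<close> it is \<open>a + b\<close>, which is what decoding needs.\<close>

definition tri_root :: "nat \<Rightarrow> nat" where
  "tri_root = rec_nat 0 (\<lambda>n k. if triangle (Suc k) - Suc n = 0 then Suc k else k)"

lemma tri_root: "triangle (tri_root n) \<le> n \<and> n < triangle (Suc (tri_root n))"
  by (induction n) (auto simp: tri_root_def)

lemma tri_root_unique:
  assumes "triangle k \<le> n" "n < triangle (Suc k)"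
  shows "tri_root n = k"
proof -
  have mono: "triangle i \<le> triangle j" if "i \<le> j" for i j
    using that by (induction j rule: dec_induct) auto
  have "\<not> Suc k \<le> tri_root n" "\<not> Suc (tri_root n) \<le> k"
    using tri_root[of n] assms mono[of "Suc k" "tri_root n"] mono[of "Suc (tri_root n)" k] by linarith+
  then show ?thesis by simp
qed

lemma prod_decode_tri_root:
  "prod_decode n = (n - triangle (tri_root n), tri_root n - (n - triangle (tri_root n)))"
proof -
  obtain a b where ab: "prod_decode n = (a, b)" by fastforce
  have "prod_encode (a, b) = n" using prod_decode_inverse[of n] ab by simp
  then have n: "n = triangle (a + b) + a" by (simp add: prod_encode_def)
  then have "tri_root n = a + b" by (intro tri_root_unique) auto
  with ab n show ?thesis by simp
qed

lemma rec_fun_tri_root: "rec_fun 1 (\<lambda>xs. tri_root (xs ! 0))"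
  unfolding tri_root_def
  by (intro rec_fun_rec_nat rec_fun_const rec_fun_if0 rec_fun_diff rec_fun_triangle rec_fun_Suc rec_fun_nth) auto

lemma computable_fst_prod_decode: "computable (\<lambda>x. fst (prod_decode x))"
  unfolding computable_iff_rec_fun prod_decode_tri_root fst_conv
  by (intro rec_fun_diff rec_fun_triangle rec_fun_tri_root rec_fun_nth) auto

lemma computable_snd_prod_decode: "computable (\<lambda>x. snd (prod_decode x))"
  unfolding computable_iff_rec_fun prod_decode_tri_root snd_conv
  by (intro rec_fun_diff rec_fun_triangle rec_fun_tri_root rec_fun_nth) auto

section \<open>Computability on encoded types\<close>

class encodable =
  fixes enc :: "'a \<Rightarrow> nat"
  assumes enc_inject: "enc x = enc y \<Longrightarrow> x = y"

lemma enc_eq_iff [simp]: "enc x = enc y \<longleftrightarrow> x = y"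
  using enc_inject by blast

instantiation nat :: encodable
begin
definition enc_nat :: "nat \<Rightarrow> nat" where [simp]: "enc_nat n = n"
instance by standard simp
end

instantiation bool :: encodable
begin
definition enc_bool :: "bool \<Rightarrow> nat" where "enc_bool b = (if b then 1 else 0)"
instance by standard (auto simp: enc_bool_def split: if_splits)
end

instantiation prod :: (encodable, encodable) encodable
begin
definition enc_prod :: "'a \<times> 'b \<Rightarrow> nat" where
  "enc_prod p = prod_encode (enc (fst p), enc (snd p))"
instance by standard (auto simp: enc_prod_def prod_eq_iff)
end

instantiation list :: (encodable) encodable
begin
definition enc_list :: "'a list \<Rightarrow> nat" where "enc_list xs = list_encode (map enc xs)"
instance
proof
  fix xs ys :: "'a list"
  assume "enc xs = enc ys"
  then have "map enc xs = map (enc :: 'a \<Rightarrow> nat) ys" by (simp add: enc_list_def list_encode_eq)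
  moreover have "inj (enc :: 'a \<Rightarrow> nat)" by (rule injI) (rule enc_inject)
  ultimately show "xs = ys" by (simp add: inj_map_eq_map)
qed
end

lemma enc_Nil [simp]: "enc [] = 0"
  by (simp add: enc_list_def)

lemma enc_Cons: "enc (x # xs) = Suc (prod_encode (enc x, enc xs))"
  by (simp add: enc_list_def)

text \<open>The code of a list is itself a computable bound on the number of iterations needed to
  traverse the list.\<close>

lemma length_le_enc: "length xs \<le> enc xs"
  by (induction xs) (auto simp: enc_Cons intro: order_trans[OF _ le_prod_encode_2])

text \<open>\<open>F\<close> is total but constrained on codes only, so neither a decoder nor a test
  for being a code is required.\<close>

definition compu :: "('a::encodable \<Rightarrow> 'b::encodable) \<Rightarrow> bool" where
  "compu f \<longleftrightarrow> (\<exists>F. computable F \<and> (\<forall>x. F (enc x) = enc (f x)))"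

lemma compuI: "rec_fun 1 (\<lambda>xs. F (xs ! 0)) \<Longrightarrow> (\<And>x. F (enc x) = enc (f x)) \<Longrightarrow> compu f"
  unfolding compu_def computable_iff_rec_fun by blast

lemma compu_iff_computable: "compu f \<longleftrightarrow> computable f"
  unfolding compu_def computable_def by auto

lemma compu_lift1:
  assumes "compu f" "\<And>a. rec_fun 1 a \<Longrightarrow> rec_fun 1 (\<lambda>xs. \<phi> (a xs))" "\<And>x. \<phi> (enc (f x)) = enc (h x)"
  shows "compu h"
proof -
  obtain F where F: "computable F" "\<And>x. F (enc x) = enc (f x)" using assms(1) unfolding compu_def by blast
  show ?thesis
    by (rule compuI[of "\<lambda>n. \<phi> (F n)"])
       (intro assms(2) rec_fun_computable[OF F(1)] rec_fun_nth, simp_all add: F assms(3))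
qed

lemma compu_lift2:
  assumes "compu f" "compu g"
    and "\<And>a b. rec_fun 1 a \<Longrightarrow> rec_fun 1 b \<Longrightarrow> rec_fun 1 (\<lambda>xs. \<phi> (a xs) (b xs))"
    and "\<And>x. \<phi> (enc (f x)) (enc (g x)) = enc (h x)"
  shows "compu h"
proof -
  obtain F where F: "computable F" "\<And>x. F (enc x) = enc (f x)" using assms(1) unfolding compu_def by blast
  obtain G where G: "computable G" "\<And>x. G (enc x) = enc (g x)" using assms(2) unfolding compu_def by blast
  show ?thesis
    by (rule compuI[of "\<lambda>n. \<phi> (F n) (G n)"])
       (intro assms(3) rec_fun_computable[OF F(1)] rec_fun_computable[OF G(1)] rec_fun_nth,
        simp_all add: F G assms(4))
qed

lemma compu_compose:
  assumes "compu f" "compu g" shows "compu (\<lambda>x. f (g x))"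
proof -
  obtain F where F: "computable F" "\<And>x. F (enc x) = enc (f x)" using assms(1) unfolding compu_def by blast
  show ?thesis
    by (rule compu_lift1[OF assms(2), of F]) (auto simp: F intro: rec_fun_computable[OF F(1)])
qed

named_theorems compu_intros

lemma compu_id [compu_intros]: "compu (\<lambda>x. x)"
  by (rule compuI[of "\<lambda>n. n"]) (auto intro: rec_fun_nth)

lemma compu_const [compu_intros]: "compu (\<lambda>x. c)"
  by (rule compuI[of "\<lambda>n. enc c"]) (auto intro: rec_fun_const)

lemma compu_Pair [compu_intros]: "compu f \<Longrightarrow> compu g \<Longrightarrow> compu (\<lambda>x. (f x, g x))"
  by (erule (1) compu_lift2[where \<phi> = "\<lambda>a b. prod_encode (a, b)"])
     (auto simp: enc_prod_def intro: rec_fun_prod_encode)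

lemma compu_fst [compu_intros]: "compu f \<Longrightarrow> compu (\<lambda>x. fst (f x))"
  by (erule compu_lift1[where \<phi> = "\<lambda>n. fst (prod_decode n)"])
     (auto simp: enc_prod_def intro: rec_fun_computable[OF computable_fst_prod_decode])

lemma compu_snd [compu_intros]: "compu f \<Longrightarrow> compu (\<lambda>x. snd (f x))"
  by (erule compu_lift1[where \<phi> = "\<lambda>n. snd (prod_decode n)"])
     (auto simp: enc_prod_def intro: rec_fun_computable[OF computable_snd_prod_decode])

lemma compu_If [compu_intros]:
  assumes "compu c" "compu f" "compu g"
  shows "compu (\<lambda>x. if c x then f x else g x)"
proof -
  obtain C where C: "computable C" "\<And>x. C (enc x) = enc (c x)" using assms(1) unfolding compu_def by blast
  obtain F where F: "computable F" "\<And>x. F (enc x) = enc (f x)" using assms(2) unfolding compu_def by blast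
  obtain G where G: "computable G" "\<And>x. G (enc x) = enc (g x)" using assms(3) unfolding compu_def by blast
  have "rec_fun 1 (\<lambda>xs. (\<lambda>n. if C n = 0 then G n else F n) (xs ! 0))"
    by (intro rec_fun_if0 rec_fun_computable[OF C(1)] rec_fun_computable[OF F(1)]
        rec_fun_computable[OF G(1)] rec_fun_nth) simp_all
  then show ?thesis by (rule compuI) (simp add: C F G enc_bool_def)
qed

text \<open>The context \<open>x\<close> is packed with \<open>k\<close> and \<open>r\<close> into
  one argument, so that the rule applies below binders. Its code stays fixed during the recursion,
  and every intermediate value is again a code.\<close>

lemma compu_rec_nat [compu_intros]:
  assumes "compu a" "compu (\<lambda>p. g (fst p) (fst (snd p)) (snd (snd p)))" "compu m"
  shows "compu (\<lambda>x. rec_nat (a x) (\<lambda>k r. g x k r) (m x))"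
proof -
  obtain A where A: "computable A" "\<And>x. A (enc x) = enc (a x)" using assms(1) unfolding compu_def by blast
  obtain G where G: "computable G"
    "\<And>p. G (enc p) = enc (g (fst p) (fst (snd p)) (snd (snd p)))" using assms(2) unfolding compu_def by blast
  obtain M where M: "computable M" "\<And>x. M (enc x) = enc (m x)" using assms(3) unfolding compu_def by blast
  show ?thesis
  proof (rule compuI)
    show "rec_fun 1 (\<lambda>xs. (\<lambda>n. rec_nat (A n) (\<lambda>k r. G (prod_encode (n, prod_encode (k, r)))) (M n)) (xs ! 0))"
      by (intro rec_fun_rec_nat rec_fun_computable[OF A(1)] rec_fun_computable[OF G(1)]
        rec_fun_computable[OF M(1)] rec_fun_prod_encode rec_fun_nth)
         (auto simp: nth_tl intro!: rec_fun_cong[OF rec_fun_nth[of 2]] simp: numeral_2_eq_2)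
    fix x
    have "rec_nat (A (enc x)) (\<lambda>k r. G (prod_encode (enc x, prod_encode (k, r)))) n =
        enc (rec_nat (a x) (\<lambda>k r. g x k r) n)" for n
    proof (induction n)
      case (Suc n)
      then show ?case using G(2)[of "(x, n, rec_nat (a x) (\<lambda>k r. g x k r) n)"]
        by (simp add: enc_prod_def)
    qed (simp add: A)
    then show "rec_nat (A (enc x)) (\<lambda>k r. G (prod_encode (enc x, prod_encode (k, r)))) (M (enc x)) =
        enc (rec_nat (a x) (\<lambda>k r. g x k r) (m x))" by (simp add: M)
  qed
qed

section \<open>Closure rules for arithmetic, logic and lists\<close>

lemma compu_Suc [compu_intros]: "compu f \<Longrightarrow> compu (\<lambda>x. Suc (f x))"
  by (erule compu_lift1[where \<phi> = Suc]) (auto intro: rec_fun_Suc)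

lemma compu_add [compu_intros]: "compu f \<Longrightarrow> compu g \<Longrightarrow> compu (\<lambda>x. f x + g x :: nat)"
  by (erule (1) compu_lift2[where \<phi> = "\<lambda>a b. a + b"]) (auto intro: rec_fun_add)

lemma compu_mult [compu_intros]: "compu f \<Longrightarrow> compu g \<Longrightarrow> compu (\<lambda>x. f x * g x :: nat)"
  by (erule (1) compu_lift2[where \<phi> = "\<lambda>a b. a * b"]) (auto intro: rec_fun_mult)

lemma compu_diff [compu_intros]: "compu f \<Longrightarrow> compu g \<Longrightarrow> compu (\<lambda>x. f x - g x :: nat)"
  by (erule (1) compu_lift2[where \<phi> = "\<lambda>a b. a - b"]) (auto intro: rec_fun_diff)

lemma compu_power [compu_intros]:
  assumes "compu f" "compu g" shows "compu (\<lambda>x. f x ^ g x :: nat)"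
proof -
  have eq: "(a :: nat) ^ n = rec_nat 1 (\<lambda>k r. r * a) n" for a n by (induction n) auto
  show ?thesis unfolding eq by (intro compu_intros assms compu_compose[OF assms(1)])
qed

lemma compu_eq [compu_intros]: "compu f \<Longrightarrow> compu g \<Longrightarrow> compu (\<lambda>x. f x = g x)"
proof (erule (1) compu_lift2[where \<phi> = "\<lambda>a b. 1 - ((a - b) + (b - a))"])
  fix x
  show "1 - ((enc (f x) - enc (g x)) + (enc (g x) - enc (f x))) = enc (f x = g x)"
    by (cases "enc (f x)" "enc (g x)" rule: linorder_cases) (auto simp: enc_bool_def)
qed (intro rec_fun_diff rec_fun_add rec_fun_const)

lemma compu_Not [compu_intros]: "compu P \<Longrightarrow> compu (\<lambda>x. \<not> P x)"
  using compu_If[of P "\<lambda>_. False" "\<lambda>_. True", OF _ compu_const compu_const] by (simp add: if_bool_eq_disj)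

lemma compu_conj [compu_intros]: "compu P \<Longrightarrow> compu Q \<Longrightarrow> compu (\<lambda>x. P x \<and> Q x)"
  using compu_If[of P Q "\<lambda>_. False", OF _ _ compu_const] by (simp add: if_bool_eq_disj)

lemma compu_disj [compu_intros]: "compu P \<Longrightarrow> compu Q \<Longrightarrow> compu (\<lambda>x. P x \<or> Q x)"
  using compu_Not[OF compu_conj[OF compu_Not compu_Not, of P Q]] by simp

lemma compu_le [compu_intros]:
  assumes "compu f" "compu g" shows "compu (\<lambda>x. (f x :: nat) \<le> g x)"
  unfolding diff_is_0_eq[symmetric] by (intro compu_intros assms)

lemma compu_Cons [compu_intros]: "compu f \<Longrightarrow> compu g \<Longrightarrow> compu (\<lambda>x. f x # g x)"
  by (erule (1) compu_lift2[where \<phi> = "\<lambda>a b. Suc (prod_encode (a, b))"])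
     (auto simp: enc_Cons intro: rec_fun_Suc rec_fun_prod_encode)

lemma compu_case_list [compu_intros]:
  assumes "compu a" "compu (\<lambda>p. b (fst p) (fst (snd p)) (snd (snd p)))" "compu l"
  shows "compu (\<lambda>x. case l x of [] \<Rightarrow> a x | y # ys \<Rightarrow> b x y ys)"
proof -
  obtain A where A: "computable A" "\<And>x. A (enc x) = enc (a x)" using assms(1) unfolding compu_def by blast
  obtain B where B: "computable B"
    "\<And>p. B (enc p) = enc (b (fst p) (fst (snd p)) (snd (snd p)))" using assms(2) unfolding compu_def by blast
  obtain L where L: "computable L" "\<And>x. L (enc x) = enc (l x)" using assms(3) unfolding compu_def by blast
  show ?thesis
  proof (rule compuI)
    show "rec_fun 1 (\<lambda>xs. (\<lambda>n. if L n = 0 then A n else B (prod_encode (n, L n - 1))) (xs ! 0))"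
      by (intro rec_fun_if0 rec_fun_prod_encode rec_fun_diff rec_fun_const
          rec_fun_computable[OF A(1)] rec_fun_computable[OF B(1)] rec_fun_computable[OF L(1)] rec_fun_nth) auto
    fix x
    show "(if L (enc x) = 0 then A (enc x) else B (prod_encode (enc x, L (enc x) - 1))) =
        enc (case l x of [] \<Rightarrow> a x | y # ys \<Rightarrow> b x y ys)"
    proof (cases "l x")
      case (Cons y ys)
      then show ?thesis using B(2)[of "(x, y, ys)"] by (simp add: L enc_Cons enc_prod_def)
    qed (simp add: L A)
  qed
qed

text \<open>The fold is iterated on pairs of remaining list and accumulator. Such a pair no longer
  changes once the list is empty, so iterating too often is harmless and the code of the list can
  serve as the number of rounds.\<close>

lemma compu_foldl [compu_intros]:
  assumes "compu a" "compu (\<lambda>p. g (fst p) (fst (snd p)) (snd (snd p)))" "compu l"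
  shows "compu (\<lambda>x. foldl (\<lambda>r y. g x r y) (a x) (l x))"
proof -
  define st where "st x = (\<lambda>s. case fst s of [] \<Rightarrow> s | y # ys \<Rightarrow> (ys, g x (snd s) y))" for x
  have st_Nil: "rec_nat ([], r) (\<lambda>k. st x) n = ([], r)" for x r n
    by (induction n) (auto simp: st_def)
  have rec_st: "rec_nat (st x s) (\<lambda>k. st x) n = st x (rec_nat s (\<lambda>k. st x) n)" for x s n
    by (induction n) auto
  have "snd (rec_nat (l, r) (\<lambda>k. st x) n) = foldl (g x) r l" if "length l \<le> n" for l r x n
    using that
  proof (induction l arbitrary: r n)
    case (Cons y ys)
    then obtain m where m: "n = Suc m" by (cases n) auto
    have "st x (y # ys, r) = (ys, g x r y)" by (simp add: st_def)
    then show ?case using Cons m by (simp flip: rec_st)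
  qed (simp add: st_Nil)
  then have eq: "foldl (g x) (a x) (l x) = snd (rec_nat (l x, a x) (\<lambda>k. st x) (enc (l x)))" for x
    using length_le_enc[of "l x"] by simp
  have 1: "compu (\<lambda>x. enc (f x))" if "compu f" for f :: "'d::encodable \<Rightarrow> 'e::encodable"
    using that unfolding compu_def by auto
  have "compu (\<lambda>q. g (fst (fst q)) (snd (snd (snd (fst q)))) (fst (snd q)))"
    using compu_compose[OF assms(2), of "\<lambda>q. (fst (fst q), snd (snd (snd (fst q))), fst (snd q))"]
    by (simp add: compu_intros)
  then show ?thesis
    unfolding eq st_def by (intro compu_intros assms 1)
qed

lemma compu_rev [compu_intros]:
  assumes "compu l" shows "compu (\<lambda>x. rev (l x))"
proof -
  have eq: "rev xs = foldl (\<lambda>r y. y # r) [] xs" for xs by (induction xs rule: rev_induct) auto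
  show ?thesis unfolding eq by (intro compu_intros assms)
qed

lemma compu_foldr [compu_intros]:
  assumes "compu a" "compu (\<lambda>p. g (fst p) (fst (snd p)) (snd (snd p)))" "compu l"
  shows "compu (\<lambda>x. foldr (\<lambda>y r. g x y r) (l x) (a x))"
proof -
  have "compu (\<lambda>p. g (fst p) (snd (snd p)) (fst (snd p)))"
    using compu_compose[OF assms(2), of "\<lambda>q. (fst q, snd (snd q), fst (snd q))"]
    by (simp add: compu_intros)
  then show ?thesis unfolding foldr_conv_foldl by (intro compu_intros assms)
qed

lemma compu_map [compu_intros]:
  assumes "compu (\<lambda>p. g (fst p) (snd p))" "compu l"
  shows "compu (\<lambda>x. map (\<lambda>y. g x y) (l x))"
proof -
  have eq: "map h ys = foldr (\<lambda>y r. h y # r) ys []" for h ys by (induction ys) auto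
  have 1: "compu (\<lambda>p. g (fst p) (fst (snd p)))"
    using compu_compose[OF assms(1), of "\<lambda>q. (fst q, fst (snd q))"] by (simp add: compu_intros)
  show ?thesis unfolding eq by (intro compu_intros assms 1)
qed

lemma compu_list_all [compu_intros]:
  assumes "compu (\<lambda>p. P (fst p) (snd p))" "compu l"
  shows "compu (\<lambda>x. list_all (\<lambda>y. P x y) (l x))"
proof -
  have eq: "list_all Q ys = foldr (\<lambda>y r. Q y \<and> r) ys True" for Q ys
    by (induction ys) auto
  have 1: "compu (\<lambda>p. P (fst p) (fst (snd p)))"
    using compu_compose[OF assms(1), of "\<lambda>q. (fst q, fst (snd q))"] by (simp add: compu_intros)
  show ?thesis unfolding eq by (intro compu_intros assms 1)
qed

lemma compu_length [compu_intros]: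
  assumes "compu l" shows "compu (\<lambda>x. length (l x))"
proof -
  have eq: "length ys = foldr (\<lambda>y r. Suc r) ys 0" for ys by (induction ys) auto
  show ?thesis unfolding eq by (intro compu_intros assms)
qed

lemma compu_tl [compu_intros]: "compu l \<Longrightarrow> compu (\<lambda>x. tl (l x))"
  unfolding tl_def by (intro compu_intros) auto

lemma compu_append [compu_intros]:
  assumes "compu l" "compu l'" shows "compu (\<lambda>x. l x @ l' x)"
proof -
  have eq: "xs @ ys = foldr (\<lambda>y r. y # r) xs ys" for xs ys by (induction xs) auto
  show ?thesis unfolding eq by (intro compu_intros assms)
qed

lemma compu_zip [compu_intros]:
  assumes "compu l" "compu l'" shows "compu (\<lambda>x. zip (l x) (l' x))"
proof -
  \<comment> \<open>Simultaneous recursion on two lists becomes a fold over the first that carries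
    the rest of the second; the result accumulates in reverse.\<close>
  have 1: "snd (foldl (\<lambda>s y. case fst s of [] \<Rightarrow> s | z # zs \<Rightarrow> (zs, (y, z) # snd s)) (zs, r) ys) =
      rev (zip ys zs) @ r" for ys zs r
    by (induction ys arbitrary: zs r) (auto split: list.split)
  have eq: "zip ys zs = rev (snd (foldl (\<lambda>s y. case fst s of [] \<Rightarrow> s | z # zs \<Rightarrow> (zs, (y, z) # snd s)) (zs, []) ys))"
    for ys zs by (simp add: 1)
  show ?thesis unfolding eq by (intro compu_intros assms)
qed

lemma compu_Ex_less [compu_intros]:
  assumes "compu (\<lambda>p. P (fst p) (snd p))" "compu m"
  shows "compu (\<lambda>x. \<exists>k<m x :: nat. P x k)"
proof -
  have eq: "(\<exists>k<n. Q k) = rec_nat False (\<lambda>k r. Q k \<or> r) n" for Q n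
    by (induction n) (auto simp: less_Suc_eq)
  have 1: "compu (\<lambda>p. P (fst p) (fst (snd p)))"
    using compu_compose[OF assms(1), of "\<lambda>q. (fst q, fst (snd q))"] by (simp add: compu_intros)
  show ?thesis unfolding eq by (intro compu_intros assms 1)
qed

lemma compu_sum [compu_intros]:
  assumes "compu (\<lambda>p. f (fst p) (snd p) :: nat)" "compu m"
  shows "compu (\<lambda>x. \<Sum>k<(m x :: nat). f x k)"
proof -
  have eq: "(\<Sum>k<n. h k) = rec_nat 0 (\<lambda>k r. h k + r) n" for h :: "nat \<Rightarrow> nat" and n
    by (induction n) auto
  have 1: "compu (\<lambda>p. f (fst p) (fst (snd p)))"
    using compu_compose[OF assms(1), of "\<lambda>q. (fst q, fst (snd q))"] by (simp add: compu_intros)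
  show ?thesis unfolding eq by (intro compu_intros assms 1)
qed

text \<open>The domain is \<open>nat\<close>, where every number is a code: on a number that codes
  nothing the unbounded search might not end, and minimisation has to be total. Several arguments
  are therefore packed into one number before a search.\<close>

lemma compu_Least [compu_intros]:
  assumes "compu (\<lambda>p. P (fst p) (snd p))" "\<And>x. \<exists>n. P x n"
  shows "compu (\<lambda>x :: nat. LEAST n :: nat. P x n)"
proof -
  obtain F where F: "computable F" "\<And>p. F (enc p) = enc (P (fst p) (snd p))"
    using assms(1) unfolding compu_def by blast
  have eq: "P x n \<longleftrightarrow> 1 - F (prod_encode (x, n)) = 0" for x n
    using F(2)[of "(x, n)"] by (auto simp: enc_prod_def enc_bool_def)
  have "computable (\<lambda>x. LEAST n. P x n)"
    using assms(2) unfolding eq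
    by (intro computable_Least rec_fun_diff rec_fun_const rec_fun_computable[OF F(1)]
        rec_fun_prod_encode rec_fun_nth) auto
  then show ?thesis by (simp add: compu_iff_computable)
qed

section \<open>Simulating Turing machines\<close>

instantiation move :: encodable
begin
definition enc_move :: "move \<Rightarrow> nat" where
  "enc_move d = (case d of MoveLeft \<Rightarrow> 0 | MoveRight \<Rightarrow> 1 | Stay \<Rightarrow> 2)"
instance by standard (auto simp: enc_move_def split: move.splits)
end

lemma compu_filter [compu_intros]:
  assumes "compu (\<lambda>p. P (fst p) (snd p))" "compu l"
  shows "compu (\<lambda>x. filter (\<lambda>y. P x y) (l x))"
proof -
  have eq: "filter Q ys = foldr (\<lambda>y r. if Q y then y # r else r) ys []" for Q ys
    by (induction ys) auto
  have 1: "compu (\<lambda>p. P (fst p) (fst (snd p)))"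
    using compu_compose[OF assms(1), of "\<lambda>q. (fst q, fst (snd q))"] by (simp add: compu_intros)
  show ?thesis unfolding eq by (intro compu_intros assms 1)
qed

lemma compu_replicate [compu_intros]:
  assumes "compu n" "compu f" shows "compu (\<lambda>x. replicate (n x) (f x))"
proof -
  have eq: "replicate m y = rec_nat [] (\<lambda>k r. y # r) m" for m y by (induction m) auto
  show ?thesis unfolding eq by (intro compu_intros assms compu_compose[OF assms(2)])
qed

lemma compu_funpow [compu_intros]:
  fixes f :: "'a::encodable \<Rightarrow> 'b::encodable" and g :: "'a \<Rightarrow> 'b \<Rightarrow> 'b"
  assumes "compu (\<lambda>p. g (fst p) (snd p))" "compu n" "compu f"
  shows "compu (\<lambda>x. (g x ^^ n x) (f x))"
proof -
  have eq: "(h ^^ m) y = rec_nat y (\<lambda>k. h) m" for h :: "'b \<Rightarrow> 'b" and m y by (induction m) auto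
  have 1: "compu (\<lambda>p. g (fst p) (snd (snd p)))"
    using compu_compose[OF assms(1), of "\<lambda>q. (fst q, snd (snd q))"] by (simp add: compu_intros)
  show ?thesis unfolding eq by (intro compu_intros assms 1)
qed

text \<open>On codes decoding is the identity, because \<open>enc\<close> on pairs of numbers is
  Cantor pairing itself; likewise for lists below.\<close>

lemma compu_prod_decode [compu_intros]:
  assumes "compu f" shows "compu (\<lambda>x. prod_decode (f x))"
proof (rule compu_lift1[OF assms, of "\<lambda>n. n"])
  fix x show "enc (f x) = enc (prod_decode (f x))"
    by (simp add: enc_prod_def)
qed

lemma compu_list_decode [compu_intros]:
  assumes "compu f" shows "compu (\<lambda>x. list_decode (f x))"
proof (rule compu_lift1[OF assms, of "\<lambda>n. n"])
  fix x
  have "map (enc :: nat \<Rightarrow> nat) = id" by (simp add: fun_eq_iff map_idI)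
  then show "enc (f x) = enc (list_decode (f x))" by (simp add: enc_list_def)
qed

lemma compu_prod_encode [compu_intros]: "compu f \<Longrightarrow> compu (\<lambda>x. prod_encode (f x))"
  by (erule compu_lift1[of _ "\<lambda>n. n"]) (auto simp: enc_prod_def)

lemma compu_first_cell [compu_intros]: "compu f \<Longrightarrow> compu (\<lambda>x. first_cell (f x))"
  unfolding first_cell_def by (intro compu_intros)

lemma compu_move_head [compu_intros]:
  assumes "compu d" "compu t" shows "compu (\<lambda>x. move_head (d x) (t x))"
proof -
  have eq: "move_head m s = (if m = MoveLeft then (tl (fst s), first_cell (fst s) # snd s)
      else if m = MoveRight then (first_cell (snd s) # fst s, tl (snd s)) else s)" for m s
    by (cases m; cases s) auto
  show ?thesis unfolding eq by (intro compu_intros assms)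
qed

text \<open>Replaces \<open>find\<close> and pattern matching by \<open>filter\<close>, projections
  and \<open>zip\<close>, for which closure rules are available.\<close>

lemma step_eq:
  "step M c = (if fst c = accept_state then c else
     case filter (\<lambda>i. fst i = fst c \<and> map fst (fst (snd i)) = map scan (snd c)) (snd M) of
       [] \<Rightarrow> c
     | i # _ \<Rightarrow> (snd (snd i), map (\<lambda>p. move_head (snd (snd (fst p))) (put (fst (snd (fst p))) (snd p)))
         (zip (fst (snd i)) (snd c))))"
proof -
  have find: "find P xs = (case filter P xs of [] \<Rightarrow> None | x # _ \<Rightarrow> Some x)" for P and xs :: "instr list"
    by (induction xs) auto
  show ?thesis
    unfolding step_def applicable_def find by (simp add: case_prod_unfold split: list.split)
qed

lemma compu_step [compu_intros]: "compu M \<Longrightarrow> compu c \<Longrightarrow> compu (\<lambda>x. step (M x) (c x))"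
proof -
  have "compu (\<lambda>p. step (fst p) (snd p))"
    unfolding step_eq put_def scan_def by (intro compu_intros)
  from compu_compose[OF this, of "\<lambda>x. (M x, c x)"] show "compu M \<Longrightarrow> compu c \<Longrightarrow> ?thesis"
    by (simp add: compu_Pair)
qed

lemma compu_accepts_within [compu_intros]:
  "compu M \<Longrightarrow> compu w \<Longrightarrow> compu t \<Longrightarrow> compu (\<lambda>x. accepts_within (M x) (w x) (t x))"
proof -
  have "compu (\<lambda>p. accepts_within (fst p) (fst (snd p)) (snd (snd p)))"
    unfolding accepts_within_def run_def start_config_def by (intro compu_intros)
  from compu_compose[OF this, of "\<lambda>x. (M x, w x, t x)"]
  show "compu M \<Longrightarrow> compu w \<Longrightarrow> compu t \<Longrightarrow> ?thesis" by (simp add: compu_Pair)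
qed

lemma compu_machine_decode [compu_intros]:
  "compu f \<Longrightarrow> compu (\<lambda>x. machine_decode (f x))"
  unfolding machine_decode_def instr_decode_def action_decode_def move_decode_def case_prod_unfold
  by (intro compu_intros) (auto intro: compu_compose)

lemma compu_ptime_set [compu_intros]:
  assumes "compu i" "compu w" shows "compu (\<lambda>x. w x \<in> ptime_set (i x))"
proof -
  have eq: "v \<in> ptime_set j \<longleftrightarrow> accepts_within (machine_decode (fst (prod_decode j))) v
      (length v ^ snd (prod_decode j) + snd (prod_decode j))" for v j
    by (simp add: ptime_set_def case_prod_unfold)
  show ?thesis unfolding eq by (intro compu_intros assms)
qed

section \<open>Upper bound: non-inclusion is recursively enumerable\<close>

lemma rec_enumerable_Ex:
  assumes "compu (\<lambda>p :: nat \<times> nat. P (fst p) (snd p))"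
  shows "rec_enumerable {x. \<exists>k. P x k}"
proof (cases "\<exists>x k. P x k")
  case True
  then obtain x0 k0 where 0: "P x0 k0" by blast
  then have 1: "\<exists>k. P x0 k" by blast
  \<comment> \<open>An enumerating function is total, so pairs \<open>(x, k)\<close> without the
    property are sent to the known element \<open>x0\<close>.\<close>
  define f where "f n = (if P (fst (prod_decode n)) (snd (prod_decode n)) then fst (prod_decode n) else x0)" for n
  have "compu (\<lambda>n :: nat. P (fst (prod_decode n)) (snd (prod_decode n)))"
    using compu_compose[OF assms, of "\<lambda>n :: nat. prod_decode n"] by (simp add: compu_intros)
  then have "compu f" unfolding f_def by (intro compu_intros)
  moreover have "{x. \<exists>k. P x k} = range f"
  proof (intro set_eqI iffI)
    fix x assume "x \<in> {x. \<exists>k. P x k}"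
    then obtain k where "P x k" by blast
    then have "x = f (prod_encode (x, k))" by (simp add: f_def)
    then show "x \<in> range f" by blast
  qed (auto simp: f_def 1 split: if_splits)
  ultimately show ?thesis unfolding rec_enumerable_def compu_iff_computable by blast
next
  case False
  then show ?thesis by (simp add: rec_enumerable_def)
qed

lemma Pi01_preorder_ptime_subset: "Pi01_preorder {(i, j). ptime_set i \<subseteq> ptime_set j}"
proof -
  \<comment> \<open>A surjective numbering of words suffices: \<open>1\<close> stands for
    \<open>True\<close> and every other entry for \<open>False\<close>.\<close>
  define word where "word k = map (\<lambda>n. n = 1) (list_decode k)" for k :: nat
  have surj: "\<exists>k. w = word k" for w
  proof -
    have "w = word (list_encode (map (\<lambda>b. if b then 1 else 0) w))"
      by (simp add: word_def comp_def map_idI)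
    then show ?thesis ..
  qed
  let ?Q = "\<lambda>x k. word k \<in> ptime_set (fst (prod_decode x)) \<and> \<not> word k \<in> ptime_set (snd (prod_decode x))"
  have "compu (\<lambda>p :: nat \<times> nat. ?Q (fst p) (snd p))"
    unfolding word_def by (intro compu_intros)
  then have "rec_enumerable {x. \<exists>k. ?Q x k}" by (rule rec_enumerable_Ex)
  moreover have "{x. \<exists>k. ?Q x k} = prod_encode ` (- {(i, j). ptime_set i \<subseteq> ptime_set j})"
  proof (intro set_eqI iffI)
    fix x assume "x \<in> {x. \<exists>k. ?Q x k}"
    then show "x \<in> prod_encode ` (- {(i, j). ptime_set i \<subseteq> ptime_set j})"
      by (intro image_eqI[of _ _ "prod_decode x"]) (auto simp: case_prod_unfold)
  next
    fix x assume "x \<in> prod_encode ` (- {(i, j). ptime_set i \<subseteq> ptime_set j})"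
    then obtain i j w where "x = prod_encode (i, j)" "w \<in> ptime_set i" "w \<notin> ptime_set j" by auto
    with surj[of w] show "x \<in> {x. \<exists>k. ?Q x k}" by auto
  qed
  ultimately have "Pi01 {(i, j). ptime_set i \<subseteq> ptime_set j}" by (simp add: Pi01_def)
  then show ?thesis
    by (auto simp: Pi01_preorder_def preorder_on_def refl_on_def trans_def)
qed

section \<open>Counter programs\<close>

datatype com = Inc nat | Dec nat | Seq com com | While nat com

text \<open>Elementary commands and loop tests cost one unit each, sequencing costs nothing; this is
  exactly the number of machine steps after compilation.\<close>

inductive exec :: "com \<Rightarrow> (nat \<Rightarrow> nat) \<Rightarrow> nat \<Rightarrow> (nat \<Rightarrow> nat) \<Rightarrow> bool" where
  Inc: "exec (Inc r) \<sigma> 1 (\<sigma>(r := Suc (\<sigma> r)))"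
| Dec: "exec (Dec r) \<sigma> 1 (\<sigma>(r := \<sigma> r - 1))"
| Seq: "exec c \<sigma> m \<tau> \<Longrightarrow> exec d \<tau> n \<upsilon> \<Longrightarrow> exec (Seq c d) \<sigma> (m + n) \<upsilon>"
| While_zero: "\<sigma> r = 0 \<Longrightarrow> exec (While r c) \<sigma> 1 \<sigma>"
| While_pos: "\<sigma> r > 0 \<Longrightarrow> exec c \<sigma> m \<tau> \<Longrightarrow> exec (While r c) \<tau> n \<upsilon> \<Longrightarrow>
    exec (While r c) \<sigma> (Suc (m + n)) \<upsilon>"

lemma exec_register_le: "exec c \<sigma> n \<tau> \<Longrightarrow> \<tau> r \<le> \<sigma> r + n"
  by (induction rule: exec.induct) auto

text \<open>Correctness is proved without counting; where a running time matters, it is later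
  obtained as a witness of this existence statement.\<close>

definition runs :: "com \<Rightarrow> (nat \<Rightarrow> nat) \<Rightarrow> (nat \<Rightarrow> nat) \<Rightarrow> bool" where
  "runs c \<sigma> \<tau> \<longleftrightarrow> (\<exists>n. exec c \<sigma> n \<tau>)"

lemma runs_Inc: "runs (Inc r) \<sigma> (\<sigma>(r := Suc (\<sigma> r)))"
  unfolding runs_def by (blast intro: exec.Inc)

lemma runs_Dec: "runs (Dec r) \<sigma> (\<sigma>(r := \<sigma> r - 1))"
  unfolding runs_def by (blast intro: exec.Dec)

lemma runs_Seq: "runs c \<sigma> \<tau> \<Longrightarrow> runs d \<tau> \<upsilon> \<Longrightarrow> runs (Seq c d) \<sigma> \<upsilon>"
  unfolding runs_def by (blast intro: exec.Seq)

lemma runs_cong: "runs c \<sigma> \<tau> \<Longrightarrow> \<tau> = \<tau>' \<Longrightarrow> runs c \<sigma> \<tau>'"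
  by simp

text \<open>\<open>s i\<close> is the state at the loop test after \<open>i\<close> passes; the
  induction is on the number \<open>k\<close> of passes still to come.\<close>

lemma runs_While:
  assumes "\<And>i. i < N \<Longrightarrow> s i r > 0 \<and> runs c (s i) (s (Suc i))" "s N r = 0"
  shows "runs (While r c) (s 0) (s N)"
proof -
  have "runs (While r c) (s (N - k)) (s N)" if "k \<le> N" for k
    using that
  proof (induction k)
    case 0
    then show ?case using assms(2) by (auto simp: runs_def intro: exec.While_zero)
  next
    case (Suc k)
    then have "s (N - Suc k) r > 0 \<and> runs c (s (N - Suc k)) (s (N - k))"
      using assms(1)[of "N - Suc k"] by (simp add: Suc_diff_Suc)
    moreover have "runs (While r c) (s (N - k)) (s N)" using Suc by simp
    ultimately show ?case unfolding runs_def by (blast intro: exec.While_pos)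
  qed
  from this[of N] show ?thesis by simp
qed

section \<open>Counter programs for recursive functions\<close>

definition clear :: "nat \<Rightarrow> com" where
  "clear r = While r (Dec r)"

lemma runs_clear: "runs (clear r) \<sigma> (\<sigma>(r := 0))"
proof -
  let ?s = "\<lambda>i. \<sigma>(r := \<sigma> r - i)"
  have "runs (clear r) (?s 0) (?s (\<sigma> r))"
    unfolding clear_def
  proof (rule runs_While, rule conjI)
    fix i assume "i < \<sigma> r"
    then show "?s i r > 0" by simp
    show "runs (Dec r) (?s i) (?s (Suc i))"
      by (rule runs_cong[OF runs_Dec]) auto
  qed simp
  then show ?thesis by simp
qed

definition move_to :: "nat \<Rightarrow> nat \<Rightarrow> com" where
  "move_to a r = While a (Seq (Dec a) (Inc r))"

lemma runs_move_to:
  assumes "a \<noteq> r" shows "runs (move_to a r) \<sigma> (\<sigma>(a := 0, r := \<sigma> r + \<sigma> a))"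
proof -
  let ?s = "\<lambda>i. \<sigma>(a := \<sigma> a - i, r := \<sigma> r + i)"
  have "runs (move_to a r) (?s 0) (?s (\<sigma> a))"
    unfolding move_to_def
  proof (rule runs_While, rule conjI)
    fix i assume "i < \<sigma> a"
    then show "?s i a > 0" using assms by simp
    show "runs (Seq (Dec a) (Inc r)) (?s i) (?s (Suc i))"
      by (rule runs_cong[OF runs_Seq[OF runs_Dec runs_Inc]]) (use assms in \<open>auto simp: fun_eq_iff\<close>)
  qed (use assms in simp)
  then show ?thesis by simp
qed

text \<open>A loop reads a register only by emptying it, so the value is duplicated into
  \<open>t\<close> and then moved back.\<close>

definition copy_to :: "nat \<Rightarrow> nat \<Rightarrow> nat \<Rightarrow> com" where
  "copy_to t a r = Seq (While a (Seq (Dec a) (Seq (Inc r) (Inc t)))) (move_to t a)"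

lemma runs_copy_to:
  assumes "a \<noteq> r" "t \<noteq> a" "t \<noteq> r" "\<sigma> t = 0"
  shows "runs (copy_to t a r) \<sigma> (\<sigma>(r := \<sigma> r + \<sigma> a))"
proof -
  let ?s = "\<lambda>i. \<sigma>(a := \<sigma> a - i, r := \<sigma> r + i, t := i)"
  have "runs (While a (Seq (Dec a) (Seq (Inc r) (Inc t)))) (?s 0) (?s (\<sigma> a))"
  proof (rule runs_While, rule conjI)
    fix i assume "i < \<sigma> a"
    then show "?s i a > 0" using assms by simp
    show "runs (Seq (Dec a) (Seq (Inc r) (Inc t))) (?s i) (?s (Suc i))"
      by (rule runs_cong[OF runs_Seq[OF runs_Dec runs_Seq[OF runs_Inc runs_Inc]]])
         (use assms in \<open>auto simp: fun_eq_iff\<close>)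
  qed (use assms in simp)
  moreover have "?s 0 = \<sigma>" using assms(4) by auto
  ultimately have "runs (While a (Seq (Dec a) (Seq (Inc r) (Inc t)))) \<sigma> (?s (\<sigma> a))" by simp
  from runs_Seq[OF this runs_move_to[of t a]] assms show ?thesis
    unfolding copy_to_def by (auto elim!: runs_cong simp: fun_eq_iff)
qed

text \<open>
  Registers from \<open>b\<close> on are scratch space: they must be zero initially and are zero again at the end,
  since the final state differs from the initial one only in \<open>out\<close>.
\<close>

definition implements :: "com \<Rightarrow> (nat list \<Rightarrow> nat) \<Rightarrow> nat list \<Rightarrow> nat \<Rightarrow> nat \<Rightarrow> bool" where
  "implements c F args out b \<longleftrightarrow>
     (\<forall>\<sigma>. (\<forall>i\<ge>b. \<sigma> i = 0) \<longrightarrow> \<sigma> out = 0 \<longrightarrow> runs c \<sigma> (\<sigma>(out := F (map \<sigma> args))))"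

lemma implementsD:
  "implements c F args out b \<Longrightarrow> (\<And>i. i \<ge> b \<Longrightarrow> \<sigma> i = 0) \<Longrightarrow> \<sigma> out = 0 \<Longrightarrow>
    runs c \<sigma> (\<sigma>(out := F (map \<sigma> args)))"
  unfolding implements_def by blast

text \<open>Quantifying over all register assignments makes programs relocatable: a compound program
  raises \<open>b\<close> for its parts and keeps the registers in between for intermediate
  results.\<close>

definition implementable :: "nat \<Rightarrow> (nat list \<Rightarrow> nat) \<Rightarrow> bool" where
  "implementable n F \<longleftrightarrow> (\<forall>args out b. length args = n \<longrightarrow> (\<forall>a\<in>set args. a < b) \<longrightarrow> out < b \<longrightarrow>
     out \<notin> set args \<longrightarrow> (\<exists>c. implements c F args out b))"

lemma implementable_nth: "i < n \<Longrightarrow> implementable n (\<lambda>xs. xs ! i)"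
  unfolding implementable_def implements_def
proof (intro allI impI)
  fix args :: "nat list" and out b :: nat
  assume *: "i < n" "length args = n" "\<forall>a\<in>set args. a < b" "out < b" "out \<notin> set args"
  show "\<exists>c. \<forall>\<sigma>. (\<forall>i\<ge>b. \<sigma> i = 0) \<longrightarrow> \<sigma> out = 0 \<longrightarrow> runs c \<sigma> (\<sigma>(out := map \<sigma> args ! i))"
  proof (intro exI allI impI)
    fix \<sigma> :: "nat \<Rightarrow> nat"
    assume "\<forall>i\<ge>b. \<sigma> i = 0" "\<sigma> out = 0"
    moreover have "args ! i \<in> set args" using * by simp
    ultimately show "runs (copy_to b (args ! i) out) \<sigma> (\<sigma>(out := map \<sigma> args ! i))"
      using * by (intro runs_cong[OF runs_copy_to]) auto
  qed
qed

lemma implementable_comp: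
  assumes F: "implementable m F" and m: "length gs = m" and G: "\<forall>g\<in>set gs. implementable n g"
  shows "implementable n (\<lambda>xs. F (map (\<lambda>g. g xs) gs))"
  unfolding implementable_def
proof (intro allI impI)
  fix args :: "nat list" and out b :: nat
  assume *: "length args = n" "\<forall>a\<in>set args. a < b" "out < b" "out \<notin> set args"
  let ?s = "\<lambda>k \<sigma> r. if b \<le> r \<and> r < b + k then (gs ! (r - b)) (map \<sigma> args) else \<sigma> r"
  have 1: "\<exists>c. \<forall>\<sigma>. (\<forall>i\<ge>b. \<sigma> i = 0) \<longrightarrow> runs c \<sigma> (?s k \<sigma>)" if "k \<le> m" for k
    using that
  proof (induction k)
    case 0
    \<comment> \<open>The language has no empty program; an increment followed by a decrement has no
      net effect.\<close>
    have "runs (Seq (Inc 0) (Dec 0)) \<sigma> (?s 0 \<sigma>)" for \<sigma>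
      by (rule runs_cong[OF runs_Seq[OF runs_Inc runs_Dec]]) auto
    then show ?case by blast
  next
    case (Suc k)
    then obtain c where c: "\<And>\<sigma>. \<forall>i\<ge>b. \<sigma> i = 0 \<Longrightarrow> runs c \<sigma> (?s k \<sigma>)" by auto
    have "implementable n (gs ! k)" using G Suc m by simp
    moreover have "\<forall>a\<in>set args. a < b + m" "b + k < b + m" "b + k \<notin> set args"
      using * Suc.prems by auto
    ultimately obtain d where d: "implements d (gs ! k) args (b + k) (b + m)"
      using *(1) unfolding implementable_def by blast
    have "runs (Seq c d) \<sigma> (?s (Suc k) \<sigma>)" if "\<forall>i\<ge>b. \<sigma> i = 0" for \<sigma>
    proof (rule runs_cong[OF runs_Seq[OF c implementsD[OF d]]])
      have "map (?s k \<sigma>) args = map \<sigma> args" using * by auto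
      then show "(?s k \<sigma>)(b + k := (gs ! k) (map (?s k \<sigma>) args)) = ?s (Suc k) \<sigma>"
        by (simp only:) (auto simp: fun_eq_iff)
    qed (use that Suc.prems in auto)
    then show ?case by blast
  qed
  have 2: "\<exists>c. \<forall>\<sigma>. runs c \<sigma> (\<lambda>r. if b \<le> r \<and> r < b + k then 0 else \<sigma> r)" for k
  proof (induction k)
    case 0
    have "runs (Seq (Inc 0) (Dec 0)) \<sigma> (\<lambda>r. if b \<le> r \<and> r < b + 0 then 0 else \<sigma> r)" for \<sigma>
      by (rule runs_cong[OF runs_Seq[OF runs_Inc runs_Dec]]) auto
    then show ?case by blast
  next
    case (Suc k)
    then obtain c where c: "\<And>\<sigma>. runs c \<sigma> (\<lambda>r. if b \<le> r \<and> r < b + k then 0 else \<sigma> r)" by blast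
    have "runs (Seq c (clear (b + k))) \<sigma> (\<lambda>r. if b \<le> r \<and> r < b + Suc k then 0 else \<sigma> r)" for \<sigma>
      by (rule runs_cong[OF runs_Seq[OF c runs_clear]]) auto
    then show ?case by blast
  qed
  obtain c where c: "\<And>\<sigma>. \<forall>i\<ge>b. \<sigma> i = 0 \<Longrightarrow> runs c \<sigma> (?s m \<sigma>)" using 1 by blast
  have "length [b..<b + m] = m" "\<forall>a\<in>set [b..<b + m]. a < b + m" "out < b + m" "out \<notin> set [b..<b + m]"
    using * by auto
  then obtain d where d: "implements d F [b..<b + m] out (b + m)"
    using F unfolding implementable_def by blast
  obtain e where e: "\<And>\<sigma>. runs e \<sigma> (\<lambda>r. if b \<le> r \<and> r < b + m then 0 else \<sigma> r)" using 2 by blast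
  have "runs (Seq c (Seq d e)) \<sigma> (\<sigma>(out := F (map (\<lambda>g. g (map \<sigma> args)) gs)))"
    if "\<forall>i\<ge>b. \<sigma> i = 0" "\<sigma> out = 0" for \<sigma>
  proof (rule runs_cong[OF runs_Seq[OF c runs_Seq[OF implementsD[OF d] e]]])
    have "map (?s m \<sigma>) [b..<b + m] = map (\<lambda>g. g (map \<sigma> args)) gs"
      using m by (intro nth_equalityI) auto
    then show "(\<lambda>r. if b \<le> r \<and> r < b + m then 0 else ((?s m \<sigma>)(out := F (map (?s m \<sigma>) [b..<b + m]))) r) =
        \<sigma>(out := F (map (\<lambda>g. g (map \<sigma> args)) gs))"
      by (simp only:) (use that * in \<open>auto simp: fun_eq_iff\<close>)
  qed (use that * in auto)
  then show "\<exists>c. implements c (\<lambda>xs. F (map (\<lambda>g. g xs) gs)) args out b"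
    unfolding implements_def by blast
qed

lemma implementable_prim_rec:
  assumes F: "implementable n f" and G: "implementable (Suc (Suc n)) g"
  shows "implementable (Suc n) (\<lambda>xs. rec_nat (f (tl xs)) (\<lambda>k r. g (k # r # tl xs)) (hd xs))"
  unfolding implementable_def
proof (intro allI impI)
  fix args :: "nat list" and out b :: nat
  assume "length args = Suc n" and *: "\<forall>a\<in>set args. a < b" "out < b" "out \<notin> set args"
  then obtain a as where as: "args = a # as" "length as = n" by (auto simp: length_Suc_conv)
  have "\<forall>x\<in>set as. x < b + 3" "out < b + 3" "out \<notin> set as"
    using * as by auto
  then obtain c where c: "implements c f as out (b + 3)"
    using F as(2) unfolding implementable_def by blast
  have "\<forall>x\<in>set (b # out # as). x < b + 3" "length (b # out # as) = Suc (Suc n)" "b + 1 < b + 3"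
    "b + 1 \<notin> set (b # out # as)"
    using * as by auto
  then obtain d where d: "implements d g (b # out # as) (b + 1) (b + 3)"
    using G unfolding implementable_def by blast
  \<comment> \<open>Layout: \<open>b\<close> counts completed passes, \<open>b + 1\<close> receives
    the new value, \<open>b + 2\<close> holds the passes left, \<open>out\<close> the current value;
    scratch space starts at \<open>b + 3\<close>.\<close>
  define body where
    "body = Seq d (Seq (clear out) (Seq (move_to (b + 1) out) (Seq (Inc b) (Dec (b + 2)))))"
  define prog where
    "prog = Seq c (Seq (copy_to (b + 3) a (b + 2)) (Seq (While (b + 2) body) (clear b)))"
  have "runs prog \<sigma> (\<sigma>(out := rec_nat (f (map \<sigma> as)) (\<lambda>k r. g (k # r # map \<sigma> as)) (\<sigma> a)))"
    if \<sigma>: "\<And>i. i \<ge> b \<Longrightarrow> \<sigma> i = 0" "\<sigma> out = 0" for \<sigma>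
  proof -
    define v where "v k = rec_nat (f (map \<sigma> as)) (\<lambda>k r. g (k # r # map \<sigma> as)) k" for k
    define s where "s k = \<sigma>(out := v k, b := k, b + 2 := \<sigma> a - k)" for k
    have body: "runs body (s k) (s (Suc k))" if "k < \<sigma> a" for k
    proof -
      have e: "map (s k) (b # out # as) = k # v k # map \<sigma> as"
        using * as by (auto simp: s_def)
      have "(s k)(b + 1 := g (map (s k) (b # out # as))) = (s k)(b + 1 := v (Suc k))"
        unfolding e by (simp add: v_def)
      moreover have "runs d (s k) ((s k)(b + 1 := g (map (s k) (b # out # as))))"
        by (rule implementsD[OF d]) (use \<sigma> * in \<open>auto simp: s_def\<close>)
      ultimately have 1: "runs d (s k) ((s k)(b + 1 := v (Suc k)))" by simp
      show ?thesis unfolding body_def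
        by (rule runs_cong[OF runs_Seq[OF 1 runs_Seq[OF runs_clear
                runs_Seq[OF runs_move_to runs_Seq[OF runs_Inc runs_Dec]]]]])
           (use \<sigma> * in \<open>auto simp: s_def fun_eq_iff\<close>)
    qed
    have loop: "runs (While (b + 2) body) (s 0) (s (\<sigma> a))"
      by (rule runs_While) (auto simp: body, auto simp: s_def)
    have s0: "runs (Seq c (copy_to (b + 3) a (b + 2))) \<sigma> (s 0)"
      by (rule runs_cong[OF runs_Seq[OF implementsD[OF c] runs_copy_to]])
         (use \<sigma> * as in \<open>auto simp: s_def v_def fun_eq_iff\<close>)
    have "runs (Seq (While (b + 2) body) (clear b)) (s 0) (\<sigma>(out := v (\<sigma> a)))"
      by (rule runs_cong[OF runs_Seq[OF loop runs_clear]]) (use \<sigma> * in \<open>auto simp: s_def fun_eq_iff\<close>)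
    then show ?thesis
      using s0 unfolding prog_def v_def runs_def
      by (auto elim!: exec.cases[of "Seq _ _"] intro!: exec.Seq)
  qed
  then show "\<exists>c. implements c (\<lambda>xs. rec_nat (f (tl xs)) (\<lambda>k r. g (k # r # tl xs)) (hd xs)) args out b"
    unfolding implements_def as by auto
qed

lemma implementable_minimise:
  assumes F: "implementable (Suc n) f" and ex: "\<forall>xs. length xs = n \<longrightarrow> (\<exists>y. f (y # xs) = 0)"
  shows "implementable n (\<lambda>xs. LEAST y. f (y # xs) = 0)"
  unfolding implementable_def
proof (intro allI impI)
  fix args :: "nat list" and out b :: nat
  assume *: "length args = n" "\<forall>a\<in>set args. a < b" "out < b" "out \<notin> set args"
  then have "\<forall>x\<in>set (out # args). x < b + 1" "length (out # args) = Suc n" "b < b + 1"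
    "b \<notin> set (out # args)"
    by auto
  then obtain c where c: "implements c f (out # args) b (b + 1)"
    using F unfolding implementable_def by blast
  \<comment> \<open>\<open>out\<close> holds the candidate and \<open>b\<close> the value of
    \<open>f\<close> at it. The loop ends when that value is \<open>0\<close>, so \<open>b\<close>
    is clean on exit.\<close>
  define body where "body = Seq (clear b) (Seq (Inc out) c)"
  have "runs (Seq c (While b body)) \<sigma> (\<sigma>(out := LEAST y. f (y # map \<sigma> args) = 0))"
    if \<sigma>: "\<And>i. i \<ge> b \<Longrightarrow> \<sigma> i = 0" "\<sigma> out = 0" for \<sigma>
  proof -
    define v where "v k = f (k # map \<sigma> args)" for k
    define L where "L = (LEAST y. v y = 0)"
    define s where "s k = \<sigma>(out := k, b := v k)" for k
    have "\<exists>y. v y = 0" using ex * by (simp add: v_def)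
    then have L: "v L = 0" "\<And>k. k < L \<Longrightarrow> v k \<noteq> 0"
      unfolding L_def by (auto intro: LeastI_ex dest: not_less_Least)
    have c': "runs c (\<sigma>(out := k)) (s k)" for k
    proof (rule runs_cong[OF implementsD[OF c]])
      have e: "map (\<sigma>(out := k)) (out # args) = k # map \<sigma> args" using * by auto
      show "(\<sigma>(out := k))(b := f (map (\<sigma>(out := k)) (out # args))) = s k"
        unfolding e by (simp add: s_def v_def)
    qed (use \<sigma> * in auto)
    have body: "runs body (s k) (s (Suc k))" for k
    proof -
      have "(s k)(b := 0, out := Suc (((s k)(b := 0)) out)) = \<sigma>(out := Suc k)"
        using \<sigma> * by (auto simp: s_def fun_eq_iff)
      then have "runs c ((s k)(b := 0, out := Suc (((s k)(b := 0)) out))) (s (Suc k))"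
        using c' by (simp only:)
      then show ?thesis
        unfolding body_def by (intro runs_Seq[OF runs_clear runs_Seq[OF runs_Inc]])
    qed
    have w: "runs (While b body) (s 0) (s L)"
    proof (rule runs_While)
      show "s i b > 0 \<and> runs body (s i) (s (Suc i))" if "i < L" for i
        using body L(2)[OF that] by (simp add: s_def)
      show "s L b = 0" using L(1) by (simp add: s_def)
    qed
    have c0: "runs c \<sigma> (s 0)" using c'[of 0] \<sigma> by (simp add: fun_upd_idem)
    have "s L = \<sigma>(out := L)" using L \<sigma>(1)[of b] * by (auto simp: s_def fun_eq_iff)
    then show ?thesis using runs_Seq[OF c0 w] by (simp add: L_def v_def)
  qed
  then show "\<exists>c. implements c (\<lambda>xs. LEAST y. f (y # xs) = 0) args out b"
    unfolding implements_def by blast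
qed

lemma implementable_zero: "implementable n (\<lambda>xs. 0)"
  unfolding implementable_def implements_def
proof (intro allI impI exI)
  fix out and \<sigma> :: "nat \<Rightarrow> nat"
  show "runs (clear out) \<sigma> (\<sigma>(out := 0))" by (rule runs_clear)
qed

lemma implementable_Suc: "implementable (Suc 0) (\<lambda>xs. Suc (xs ! 0))"
  unfolding implementable_def
proof (intro allI impI)
  fix args :: "nat list" and out b :: nat
  assume *: "length args = Suc 0" "\<forall>a\<in>set args. a < b" "out < b" "out \<notin> set args"
  then obtain c where c: "implements c (\<lambda>xs. xs ! 0) args out b"
    using implementable_nth[of 0 "Suc 0"] unfolding implementable_def by blast
  have "runs (Seq c (Inc out)) \<sigma> (\<sigma>(out := Suc (map \<sigma> args ! 0)))"
    if "\<forall>i\<ge>b. \<sigma> i = 0" "\<sigma> out = 0" for \<sigma>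
    by (rule runs_cong[OF runs_Seq[OF implementsD[OF c] runs_Inc]]) (use that in auto)
  then show "\<exists>c. implements c (\<lambda>xs. Suc (xs ! 0)) args out b"
    unfolding implements_def by blast
qed

lemma recursive_implementable: "recursive n F \<Longrightarrow> implementable n F"
proof (induction rule: recursive.induct)
  case (comp m f gs n)
  then show ?case by (intro implementable_comp) auto
qed (auto intro: implementable_zero implementable_Suc implementable_nth implementable_prim_rec
    implementable_minimise)

section \<open>Counter programs on Turing machines\<close>

text \<open>
  The tape of a counter with value \<open>v\<close> has the marker \<open>3\<close> in one cell, is blank elsewhere, and is
  scanned \<open>v\<close> cells to the right of the marker; \<open>j\<close> counts blank cells left behind by earlier moves.
\<close>

definition counter :: "nat \<Rightarrow> tape \<Rightarrow> bool" where
  "counter v t \<longleftrightarrow> (\<exists>j. t = (if v = 0 then ([], 3 # replicate j 0)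
     else (replicate (v - 1) 0 @ [3], replicate j 0)))"

lemma counter_scan: "counter v t \<Longrightarrow> scan t = (if v = 0 then 3 else 0)"
  unfolding counter_def
  by (elim exE, rename_tac j, case_tac j) (auto simp: scan_def first_cell_def)

definition shift_by :: "move \<Rightarrow> nat \<Rightarrow> nat" where
  "shift_by d v = (case d of MoveLeft \<Rightarrow> v - 1 | MoveRight \<Rightarrow> Suc v | Stay \<Rightarrow> v)"

lemma shift_by_simps [simp]:
  "shift_by MoveLeft v = v - 1" "shift_by MoveRight v = Suc v" "shift_by Stay v = v"
  by (simp_all add: shift_by_def)

text \<open>Rewriting the scanned symbol can make an implicit blank explicit, which is why
  \<open>j\<close> is left open in \<open>counter\<close>. The second premise keeps the head from
  passing to the left of the marker.\<close>

lemma counter_move: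
  assumes "counter v t" "d = MoveLeft \<Longrightarrow> v > 0"
  shows "counter (shift_by d v) (move_head d (put (scan t) t))"
proof -
  obtain j where t: "t = (if v = 0 then ([], 3 # replicate j 0) else (replicate (v - 1) 0 @ [3], replicate j 0))"
    using assms(1) unfolding counter_def by blast
  show ?thesis
  proof (cases v)
    case 0
    then show ?thesis using t assms(2)
      by (cases d) (auto simp: counter_def put_def scan_def first_cell_def)
  next
    case (Suc u)
    have p: "put (scan t) t = (replicate u 0 @ [3], replicate (Suc (j - 1)) 0)"
      using t Suc by (cases j) (auto simp: put_def scan_def first_cell_def)
    show ?thesis
    proof (cases d)
      case MoveLeft
      then show ?thesis
        unfolding p counter_def Suc
        by (cases u) (auto simp: first_cell_def intro: exI[of _ "Suc (Suc (j - 1))"] exI[of _ "Suc (j - 1)"])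
    next
      case MoveRight
      then show ?thesis unfolding p counter_def Suc
        by (auto simp: first_cell_def intro: exI[of _ "j - 1"])
    next
      case Stay
      then show ?thesis unfolding p counter_def Suc
        by (auto intro: exI[of _ "Suc (j - 1)"])
    qed
  qed
qed

definition counters :: "nat \<Rightarrow> (nat \<Rightarrow> nat) \<Rightarrow> tape list \<Rightarrow> bool" where
  "counters K \<sigma> ts \<longleftrightarrow> length ts = K \<and> (\<forall>i<K. counter (\<sigma> i) (ts ! i))"

abbreviation act :: "(nat \<times> nat \<times> move) list \<Rightarrow> tape list \<Rightarrow> tape list" where
  "act \<equiv> map2 (\<lambda>(a, b, d) t. move_head d (put b t))"

text \<open>By the last premise all instructions applicable here are equal, so the order in which
  \<open>find\<close> searches is irrelevant.\<close>

lemma step_instr: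
  assumes "(q, as, q') \<in> set I" "q \<noteq> accept_state" "map fst as = map scan ts"
    and "\<And>as' q''. (q, as', q'') \<in> set I \<Longrightarrow> map fst as' = map fst as \<Longrightarrow> as' = as \<and> q'' = q'"
  shows "step (k, I) (q, ts) = (q', act as ts)"
proof -
  let ?P = "\<lambda>(p, as, q'). p = q \<and> map fst as = map scan ts"
  have "?P (q, as, q')" using assms(3) by simp
  then have "find ?P I \<noteq> None" using assms(1) unfolding find_None_iff by blast
  then obtain i where i: "find ?P I = Some i" by blast
  then have iI: "i \<in> set I" and iP: "?P i" by (auto simp: find_Some_iff dest: nth_mem)
  obtain p as' q'' where i': "i = (p, as', q'')" by (rule prod_cases3)
  then have p: "p = q" and as': "map fst as' = map fst as" using iP assms(3) by simp_all
  then have "i = (q, as, q')" using assms(4)[of as' q''] iI unfolding i' p by blast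
  with i show ?thesis using assms(2) by (simp add: step_def applicable_def)
qed

lemma halted_no_instr:
  assumes "\<And>as q'. (q, as, q') \<in> set I \<Longrightarrow> map fst as \<noteq> map scan ts"
  shows "halted (k, I) (q, ts)"
  using assms by (auto simp: halted_def applicable_def find_None_iff)

text \<open>
  In state \<open>src\<close>, reading \<open>sym\<close> on the input tape, the edge moves the input head and acts on the
  counter \<open>reg\<close> according to whether it is zero.
\<close>

datatype edge = Edge (src: nat) (sym: nat) (in_move: move) (reg: nat)
  (zero_move: move) (zero_goto: nat) (pos_move: move) (pos_goto: nat)

definition edge_instr :: "nat \<Rightarrow> edge \<Rightarrow> nat list \<Rightarrow> instr" where
  "edge_instr K e zs = (src e, (sym e, sym e, in_move e) # map (\<lambda>i. (zs ! i, zs ! i,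
       if i \<noteq> reg e then Stay else if zs ! i = 3 then zero_move e else pos_move e)) [0..<K],
     if zs ! reg e = 3 then zero_goto e else pos_goto e)"

text \<open>An edge tests one counter, whereas an instruction prescribes the symbols on all tapes;
  each edge is therefore expanded over all \<open>2 ^ K\<close> patterns of blanks and
  markers.\<close>

definition edge_instrs :: "nat \<Rightarrow> edge list \<Rightarrow> instr list" where
  "edge_instrs K E = concat (map (\<lambda>e. map (edge_instr K e) (List.n_lists K [0, 3])) E)"

text \<open>\<open>X\<close> is for instructions that are not of edge form. The assumptions ensure
  that at most one instruction applies in a source state of an edge.\<close>

locale counter_tm =
  fixes K :: nat and X :: "instr list" and E :: "edge list"
  assumes edge_inj: "inj_on (\<lambda>e. (src e, sym e)) (set E)"
    and X_E: "\<And>x e. x \<in> set X \<Longrightarrow> e \<in> set E \<Longrightarrow> fst x \<noteq> src e"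
    and src_not_accept: "\<And>e. e \<in> set E \<Longrightarrow> src e \<noteq> accept_state"
begin

definition M :: machine where "M = (K, X @ edge_instrs K E)"

definition conf :: "(tape \<Rightarrow> bool) \<Rightarrow> nat \<Rightarrow> (nat \<Rightarrow> nat) \<Rightarrow> config \<Rightarrow> bool" where
  "conf P q \<sigma> C \<longleftrightarrow> (\<exists>it ts. C = (q, it # ts) \<and> P it \<and> counters K \<sigma> ts)"

lemma edge_step:
  assumes e: "e \<in> set E" "reg e < K" "zero_move e \<noteq> MoveLeft"
    and C: "conf (\<lambda>it. scan it = sym e \<and> Q (move_head (in_move e) (put (sym e) it))) (src e) \<sigma> C"
  shows "conf Q (if \<sigma> (reg e) = 0 then zero_goto e else pos_goto e)
    (\<sigma>(reg e := shift_by (if \<sigma> (reg e) = 0 then zero_move e else pos_move e) (\<sigma> (reg e)))) (step M C)"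
proof -
  obtain it ts where it: "C = (src e, it # ts)" "scan it = sym e"
      "Q (move_head (in_move e) (put (sym e) it))" and
    ts: "length ts = K" "\<And>i. i < K \<Longrightarrow> counter (\<sigma> i) (ts ! i)"
    using C unfolding conf_def counters_def by blast
  define zs where "zs = map scan ts"
  have zs_nth: "zs ! i = (if \<sigma> i = 0 then 3 else 0)" if "i < K" for i
    using that ts counter_scan[OF ts(2)[OF that]] by (simp add: zs_def)
  have "length zs = K" using ts by (simp add: zs_def)
  then have "z \<in> set [0, 3]" if "z \<in> set zs" for z
    using that zs_nth by (auto simp: in_set_conv_nth split: if_splits)
  with \<open>length zs = K\<close> have "zs \<in> set (List.n_lists K [0, 3])" by (auto simp: set_n_lists)
  obtain as q' where i: "edge_instr K e zs = (src e, as, q')" by (simp add: edge_instr_def)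
  then have as: "as = (sym e, sym e, in_move e) # map (\<lambda>i. (zs ! i, zs ! i,
       if i \<noteq> reg e then Stay else if zs ! i = 3 then zero_move e else pos_move e)) [0..<K]"
    and q': "q' = (if zs ! reg e = 3 then zero_goto e else pos_goto e)"
    by (simp_all add: edge_instr_def)
  have map_as: "map fst as = sym e # zs"
    using ts by (auto simp: as zs_def comp_def intro!: nth_equalityI)
  have "step M C = (q', act as (it # ts))"
    unfolding M_def it(1)
  proof (rule step_instr)
    show "(src e, as, q') \<in> set (X @ edge_instrs K E)"
      using e(1) \<open>zs \<in> _\<close> by (auto simp: edge_instrs_def simp flip: i)
    show "src e \<noteq> accept_state" using src_not_accept e by simp
    show "map fst as = map scan (it # ts)" by (simp add: map_as it zs_def)
    fix as' q''
    assume "(src e, as', q'') \<in> set (X @ edge_instrs K E)" and eq: "map fst as' = map fst as"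
    moreover have "(src e, as', q'') \<notin> set X" using X_E[of "(src e, as', q'')" e] e(1) by auto
    ultimately obtain e' zs' where e': "e' \<in> set E" "zs' \<in> set (List.n_lists K [0, 3])"
      "(src e, as', q'') = edge_instr K e' zs'"
      by (auto simp: edge_instrs_def)
    then have "length zs' = K" by (simp add: set_n_lists)
    have "map fst as' = sym e' # map (\<lambda>i. zs' ! i) [0..<K]" using e' by (simp add: edge_instr_def comp_def)
    also have "map (\<lambda>i. zs' ! i) [0..<K] = zs'" using \<open>length zs' = K\<close> by (metis map_nth)
    finally have "sym e' = sym e" "zs' = zs" using eq map_as by auto
    moreover have "src e' = src e" using e' by (simp add: edge_instr_def)
    ultimately have "e' = e" using edge_inj e(1) e'(1) by (auto dest: inj_onD)
    with \<open>zs' = zs\<close> e'(3) i show "as' = as \<and> q'' = q'" by simp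
  qed
  moreover have "q' = (if \<sigma> (reg e) = 0 then zero_goto e else pos_goto e)"
    using q' zs_nth[OF e(2)] by simp
  moreover have "counters K (\<sigma>(reg e := shift_by (if \<sigma> (reg e) = 0 then zero_move e else pos_move e) (\<sigma> (reg e))))
      (act (tl as) ts)"
    unfolding counters_def
  proof (intro conjI allI impI)
    show "length (act (tl as) ts) = K" using ts by (simp add: as)
    fix i assume i: "i < K"
    have z: "zs ! i = scan (ts ! i)" using ts i by (simp add: zs_def)
    show "counter ((\<sigma>(reg e := shift_by (if \<sigma> (reg e) = 0 then zero_move e else pos_move e) (\<sigma> (reg e)))) i)
        (act (tl as) ts ! i)"
    proof (cases "i = reg e")
      case True
      then show ?thesis
        using counter_move[OF ts(2)[OF i], of "if \<sigma> i = 0 then zero_move e else pos_move e"] i ts e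
          zs_nth[OF i] counter_scan[OF ts(2)[OF i]]
        by (auto simp: as z split: if_splits)
    next
      case False
      then show ?thesis using counter_move[OF ts(2)[OF i], of Stay] i ts by (simp add: as z)
    qed
  qed
  ultimately show ?thesis using it by (auto simp: conf_def as)
qed

lemma conf_halted:
  assumes "\<And>e. e \<in> set E \<Longrightarrow> src e = q \<Longrightarrow> \<not> P (sym e)" "\<And>x. x \<in> set X \<Longrightarrow> fst x \<noteq> q"
    and "conf (\<lambda>it. P (scan it)) q \<sigma> C"
  shows "halted M C"
proof -
  obtain it ts where C: "C = (q, it # ts)" "P (scan it)" using assms(3) unfolding conf_def by blast
  show ?thesis unfolding M_def C(1)
  proof (rule halted_no_instr)
    fix as q' assume "(q, as, q') \<in> set (X @ edge_instrs K E)"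
    moreover have "(q, as, q') \<notin> set X" using assms(2)[of "(q, as, q')"] by auto
    ultimately obtain e zs where "e \<in> set E" "(q, as, q') = edge_instr K e zs"
      by (auto simp: edge_instrs_def)
    then show "map fst as \<noteq> map scan (it # ts)"
      using assms(1)[of e] C(2) by (auto simp: edge_instr_def)
  qed
qed

end

section \<open>Compiling counter programs into edges\<close>

primrec csize :: "com \<Rightarrow> nat" where
  "csize (Inc r) = 0"
| "csize (Dec r) = 0"
| "csize (Seq c d) = Suc (csize c + csize d)"
| "csize (While r c) = Suc (csize c)"

primrec regs :: "com \<Rightarrow> nat set" where
  "regs (Inc r) = {r}"
| "regs (Dec r) = {r}"
| "regs (Seq c d) = regs c \<union> regs d"
| "regs (While r c) = insert r (regs c)"

lemma finite_regs: "finite (regs c)"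
  by (induction c) auto

text \<open>
  \<open>compile ins mv c a b n\<close> leads from state \<open>a\<close> to state \<open>b\<close>, using the fresh states
  \<open>n, \<dots>, n + csize c - 1\<close>.  Each step requires an input symbol from \<open>ins\<close> and moves the input head
  by \<open>mv\<close>, so with \<open>mv = MoveRight\<close> the remaining input acts as a clock.
\<close>

primrec compile :: "nat list \<Rightarrow> move \<Rightarrow> com \<Rightarrow> nat \<Rightarrow> nat \<Rightarrow> nat \<Rightarrow> edge list" where
  "compile ins mv (Inc r) a b n = map (\<lambda>s. Edge a s mv r MoveRight b MoveRight b) ins"
| "compile ins mv (Dec r) a b n = map (\<lambda>s. Edge a s mv r Stay b MoveLeft b) ins"
| "compile ins mv (Seq c d) a b n =
    compile ins mv c a n (Suc n) @ compile ins mv d n b (Suc n + csize c)"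
| "compile ins mv (While r c) a b n =
    map (\<lambda>s. Edge a s mv r Stay b Stay n) ins @ compile ins mv c n a (Suc n)"

lemma compile_src:
  "e \<in> set (compile ins mv c a b n) \<Longrightarrow> src e \<in> insert a {n..<n + csize c} \<and> sym e \<in> set ins"
  by (induction c arbitrary: a b n) fastforce+

text \<open>Subprograms receive disjoint intervals of fresh states and the entry \<open>a\<close>
  lies outside them, so state and symbol determine the edge.\<close>

lemma compile_inj:
  "a \<notin> {n..<n + csize c} \<Longrightarrow> inj_on (\<lambda>e. (src e, sym e)) (set (compile ins mv c a b n))"
proof (induction c arbitrary: a b n)
  case (Seq c d)
  have "inj_on (\<lambda>e. (src e, sym e)) (set (compile ins mv c a n (Suc n)))"
    "inj_on (\<lambda>e. (src e, sym e)) (set (compile ins mv d n b (Suc n + csize c)))"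
    using Seq by auto
  moreover have "src e \<noteq> src e'" if "e \<in> set (compile ins mv c a n (Suc n))"
    "e' \<in> set (compile ins mv d n b (Suc n + csize c))" for e e'
    using compile_src[OF that(1)] compile_src[OF that(2)] Seq.prems by auto
  ultimately show ?case by (auto simp: inj_on_Un dest: sym)
next
  case (While r c)
  have "inj_on (\<lambda>e. (src e, sym e)) (set (compile ins mv c n a (Suc n)))" using While by auto
  moreover have "src e \<noteq> a" if "e \<in> set (compile ins mv c n a (Suc n))" for e
    using compile_src[OF that] While.prems by auto
  ultimately show ?case by (fastforce simp: inj_on_def)
qed (auto simp: inj_on_def)

context counter_tm
begin

definition stuck :: "config \<Rightarrow> bool" where
  "stuck C \<longleftrightarrow> (\<exists>t. halted M ((step M ^^ t) C) \<and> fst ((step M ^^ t) C) \<noteq> accept_state)"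

lemma stuck_funpow: "stuck ((step M ^^ t) C) \<Longrightarrow> stuck C"
  unfolding stuck_def by (metis comp_apply funpow_add)

lemma stuck_step: "stuck (step M C) \<Longrightarrow> stuck C"
  using stuck_funpow[of 1 C] by simp

text \<open>\<open>I k it\<close> says that the input tape \<open>it\<close> allows \<open>k\<close> more steps.\<close>

context
  fixes ins :: "nat list" and mv :: move and I :: "nat \<Rightarrow> tape \<Rightarrow> bool"
  assumes I_Suc: "\<And>k it. I (Suc k) it \<Longrightarrow> scan it \<in> set ins \<and> I k (move_head mv (put (scan it) it))"
begin

lemma compile_edge_step:
  assumes "\<And>s. s \<in> set ins \<Longrightarrow> Edge a s mv r d0 q0 d1 q1 \<in> set E" "r < K" "d0 \<noteq> MoveLeft"
    and C: "conf (I (Suc k)) a \<sigma> C"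
  shows "conf (I k) (if \<sigma> r = 0 then q0 else q1)
    (\<sigma>(r := shift_by (if \<sigma> r = 0 then d0 else d1) (\<sigma> r))) (step M C)"
proof -
  obtain it ts where it: "C = (a, it # ts)" "I (Suc k) it" "counters K \<sigma> ts"
    using C unfolding conf_def by blast
  let ?e = "Edge a (scan it) mv r d0 q0 d1 q1"
  have "conf (\<lambda>it'. scan it' = sym ?e \<and> I k (move_head (in_move ?e) (put (sym ?e) it'))) (src ?e) \<sigma> C"
    using it I_Suc[OF it(2)] by (auto simp: conf_def)
  moreover have "?e \<in> set E" using assms(1) I_Suc[OF it(2)] by blast
  ultimately show ?thesis using edge_step[of ?e "I k" \<sigma> C] assms(2,3) by (cases "\<sigma> r = 0") simp_all
qed

text \<open>The surplus \<open>k\<close> is the budget left for whatever follows; for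
  \<open>Seq\<close> it absorbs the cost of the second part. One simulation lemma thereby covers the
  clocked and the unclocked phase.\<close>

lemma compile_run:
  assumes "exec c \<sigma> m \<tau>" "set (compile ins mv c a b n) \<subseteq> set E" "regs c \<subseteq> {..<K}"
    and "conf (I (m + k)) a \<sigma> C"
  shows "conf (I k) b \<tau> ((step M ^^ m) C)"
  using assms
proof (induction arbitrary: a b n C k rule: exec.induct)
  case (Inc r \<sigma>)
  then show ?case using compile_edge_step[of a r MoveRight b MoveRight b k \<sigma> C]
    by (auto simp: image_subset_iff fun_upd_def)
next
  case (Dec r \<sigma>)
  then show ?case
    using compile_edge_step[of a r Stay b MoveLeft b k \<sigma> C]
    by (cases "\<sigma> r") (auto simp: image_subset_iff fun_upd_idem fun_upd_def)
next
  case (Seq c \<sigma> m \<tau> d l \<upsilon>)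
  have "conf (I (l + k)) n \<tau> ((step M ^^ m) C)"
    using Seq.prems by (intro Seq.IH(1)) (auto simp: add.assoc)
  then have "conf (I k) b \<upsilon> ((step M ^^ l) ((step M ^^ m) C))"
    using Seq.prems by (intro Seq.IH(2)) auto
  then show ?case by (simp add: add.commute[of m] funpow_add)
next
  case (While_zero \<sigma> r c)
  then show ?case using compile_edge_step[of a r Stay b Stay n k \<sigma> C]
    by (auto simp: image_subset_iff fun_upd_idem)
next
  case (While_pos \<sigma> r c m \<tau> l \<upsilon>)
  have "conf (I (m + (l + k))) n \<sigma> (step M C)"
    using compile_edge_step[of a r Stay b Stay n "m + (l + k)" \<sigma> C] While_pos.prems While_pos.hyps(1)
    by (auto simp: image_subset_iff add.assoc)
  then have "conf (I (l + k)) a \<tau> ((step M ^^ m) (step M C))"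
    using While_pos.prems by (intro While_pos.IH(1)) auto
  then have "conf (I k) b \<upsilon> ((step M ^^ l) ((step M ^^ m) (step M C)))"
    using While_pos.prems by (intro While_pos.IH(2)) auto
  then show ?case by (simp add: add.commute[of m] funpow_add funpow_swap1)
qed

text \<open>A budget below \<open>m\<close> runs out before the exit \<open>b\<close> is reached.
  The machine is then in a state of the compiled code, all of which lie in \<open>R\<close>; there
  only symbols of \<open>ins\<close> are handled, so it halts without accepting.\<close>

lemma compile_stuck:
  assumes I_0: "\<And>it. I 0 it \<Longrightarrow> scan it \<notin> set ins"
    and R: "\<And>e. e \<in> set E \<Longrightarrow> src e \<in> R \<Longrightarrow> sym e \<in> set ins" "\<And>x. x \<in> set X \<Longrightarrow> fst x \<notin> R"
      "accept_state \<notin> R"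
    and "exec c \<sigma> m \<tau>" "set (compile ins mv c a b n) \<subseteq> set E" "regs c \<subseteq> {..<K}"
    and "insert a {n..<n + csize c} \<subseteq> R" "conf (I k) a \<sigma> C" "k < m"
  shows "stuck C"
proof -
  have halt: "stuck C" if "conf (I 0) a \<sigma> C" "a \<in> R" for a \<sigma> C
  proof -
    have "conf (\<lambda>it. scan it \<notin> set ins) a \<sigma> C" using that(1) I_0 by (auto simp: conf_def)
    then have "halted M C"
      by (intro conf_halted[where P = "\<lambda>s. s \<notin> set ins"]) (use R that(2) in auto)
    moreover have "fst C \<noteq> accept_state" using that R(3) by (auto simp: conf_def)
    ultimately show ?thesis unfolding stuck_def by (intro exI[of _ 0]) simp
  qed
  show ?thesis
    using assms(5-)
  proof (induction arbitrary: a b n C k rule: exec.induct)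
    case (Seq c \<sigma> m \<tau> d l \<upsilon>)
    show ?case
    proof (cases "k < m")
      case True
      show ?thesis using Seq.prems True by (intro Seq.IH(1)[of a n "Suc n" k C]) auto
    next
      case False
      \<comment> \<open>The first part completes and \<open>k'\<close> units remain, too few for the
        second.\<close>
      then obtain k' where k: "k = m + k'" using le_Suc_ex not_less by blast
      have "conf (I k') n \<tau> ((step M ^^ m) C)"
        using Seq.prems Seq.hyps k by (intro compile_run[OF Seq.hyps(1), of a n "Suc n"]) auto
      then have "stuck ((step M ^^ m) C)"
        using Seq.prems k by (intro Seq.IH(2)[of n b "Suc n + csize c" k']) auto
      then show ?thesis by (rule stuck_funpow)
    qed
  next
    case (While_pos \<sigma> r c m \<tau> l \<upsilon>)
    show ?case
    proof (cases k)
      case 0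
      then show ?thesis using While_pos.prems halt by auto
    next
      case (Suc k1)
      have 1: "conf (I k1) n \<sigma> (step M C)"
        using compile_edge_step[of a r Stay b Stay n k1 \<sigma> C] While_pos.prems While_pos.hyps(1) Suc
        by (auto simp: image_subset_iff)
      have "stuck (step M C)"
      proof (cases "k1 < m")
        case True
        show ?thesis using While_pos.prems True 1 by (intro While_pos.IH(1)[of n a "Suc n" k1]) auto
      next
        case False
        then obtain k' where k: "k1 = m + k'" using le_Suc_ex not_less by blast
        have "conf (I k') a \<tau> ((step M ^^ m) (step M C))"
          using While_pos.prems 1 k by (intro compile_run[OF While_pos.hyps(2), of n a "Suc n"]) auto
        then have "stuck ((step M ^^ m) (step M C))"
          using While_pos.prems k Suc by (intro While_pos.IH(2)[of a b n k']) auto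
        then show ?thesis by (rule stuck_funpow)
      qed
      then show ?thesis by (rule stuck_step)
    qed
  qed (use halt in auto)
qed

end

end

section \<open>Machines with a clocked phase\<close>

context counter_tm
begin

lemma step_accept: "fst C = accept_state \<Longrightarrow> step M' C = C"
  by (simp add: step_def applicable_def)

lemma accept_absorbing:
  assumes "fst ((step M' ^^ t) C) = accept_state" "t \<le> u"
  shows "(step M' ^^ u) C = (step M' ^^ t) C"
  using assms(2) by (induction u rule: dec_induct) (auto simp: step_accept assms(1))

lemma stuck_never_accepts:
  assumes "stuck C" shows "fst ((step M ^^ u) C) \<noteq> accept_state"
proof
  assume acc: "fst ((step M ^^ u) C) = accept_state"
  obtain t where t: "halted M ((step M ^^ t) C)" "fst ((step M ^^ t) C) \<noteq> accept_state"
    using assms unfolding stuck_def by blast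
  have hs: "step M D = D" if "halted M D" for D using that by (simp add: step_def halted_def)
  have h: "(step M ^^ v) C = (step M ^^ t) C" if "t \<le> v" for v
    using that by (induction v rule: dec_induct) (auto simp: hs[OF t(1)])
  show False
    using accept_absorbing[OF acc, of "max t u"] h[of "max t u"] acc t(2) by simp
qed

lemma accepts_iff_time:
  assumes "fst ((step M ^^ t) C) \<noteq> accept_state" "fst ((step M ^^ Suc t) C) = accept_state"
  shows "fst ((step M ^^ u) C) = accept_state \<longleftrightarrow> Suc t \<le> u"
  using accept_absorbing[of u M C t] accept_absorbing[OF assms(2), of u] assms
  by (metis not_less_eq_eq)

end

text \<open>
  The machine sets register \<open>2\<close> to \<open>x + 1\<close> (state by state, which is how \<open>x\<close> is hard-coded), reads
  the input up to the first \<open>True\<close>, counting the leading \<open>False\<close> in register \<open>0\<close>, executes \<open>V\<close>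
  clocked by the rest of the input, then \<open>U\<close> unclocked, and accepts iff register \<open>3\<close> is nonzero.
  State \<open>2\<close> has no instructions and rejects.
\<close>

definition start_instr :: "nat \<Rightarrow> nat \<Rightarrow> instr" where
  "start_instr K q = (start_state,
     (1, 1, Stay) # map (\<lambda>j. (0, 3, if j = 2 then MoveRight else Stay)) [0..<K], q)"

definition chain_instr :: "nat \<Rightarrow> nat \<Rightarrow> nat \<Rightarrow> instr" where
  "chain_instr K N i = (N + Suc i,
     (1, 1, Stay) # map (\<lambda>j. if j = 2 then (0, 0, MoveRight) else (3, 3, Stay)) [0..<K], N + i)"

definition prefix_instrs :: "nat \<Rightarrow> nat \<Rightarrow> nat \<Rightarrow> instr list" where
  "prefix_instrs K N x = start_instr K (N + x) # map (chain_instr K N) [0..<x]"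

text \<open>States \<open>0\<close> to \<open>5\<close> are start, accept, reject, entry of
  \<open>V\<close>, entry of \<open>U\<close> and final test; then come the fresh states of
  \<open>V\<close> and of \<open>U\<close>. The chain for \<open>x\<close> lies above the read
  state, so the edges do not depend on \<open>x\<close>.\<close>

definition read_state :: "com \<Rightarrow> com \<Rightarrow> nat" where
  "read_state V U = 6 + csize V + csize U"

definition body_edges :: "com \<Rightarrow> com \<Rightarrow> edge list" where
  "body_edges V U =
     [Edge (read_state V U) 1 MoveRight 0 MoveRight (read_state V U) MoveRight (read_state V U),
      Edge (read_state V U) 2 MoveRight 0 Stay 3 Stay 3] @
     compile [1, 2] MoveRight V 3 4 6 @
     compile [0, 1, 2] Stay U 4 5 (6 + csize V) @
     map (\<lambda>s. Edge 5 s Stay 3 Stay 2 Stay 1) [0, 1, 2]"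

definition clocked_machine :: "nat \<Rightarrow> com \<Rightarrow> com \<Rightarrow> nat \<Rightarrow> machine" where
  "clocked_machine K V U x =
     (K, prefix_instrs K (read_state V U) x @ edge_instrs K (body_edges V U))"

lemma inj_on_append:
  "inj_on f (set xs) \<Longrightarrow> inj_on f (set ys) \<Longrightarrow> (\<And>x y. x \<in> set xs \<Longrightarrow> y \<in> set ys \<Longrightarrow> f x \<noteq> f y) \<Longrightarrow>
    inj_on f (set (xs @ ys))"
  by (fastforce simp: inj_on_def)

lemma body_edges_src:
  assumes "e \<in> set (body_edges V U)"
  shows "src e \<in> {3..read_state V U}"
  using assms compile_src[of e "[1, 2]" MoveRight V 3 4 6]
    compile_src[of e "[0, 1, 2]" Stay U 4 5 "6 + csize V"]
  by (auto simp: body_edges_def read_state_def)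

lemma counter_tm_body: "counter_tm (prefix_instrs K (read_state V U) x) (body_edges V U)"
proof
  let ?f = "\<lambda>e. (src e, edge.sym e)"
  have V: "inj_on ?f (set (compile [1, 2] MoveRight V 3 4 6))" by (rule compile_inj) simp
  have U: "inj_on ?f (set (compile [0, 1, 2] Stay U 4 5 (6 + csize V)))" by (rule compile_inj) simp
  show "inj_on ?f (set (body_edges V U))"
    unfolding body_edges_def
    by (intro inj_on_append V U) (auto dest!: compile_src simp: read_state_def)
  show "fst i \<noteq> src e" if "i \<in> set (prefix_instrs K (read_state V U) x)" "e \<in> set (body_edges V U)" for i e
    using that(1) body_edges_src[OF that(2)]
    by (auto simp: prefix_instrs_def start_instr_def chain_instr_def start_state_def)
  show "src e \<noteq> accept_state" if "e \<in> set (body_edges V U)" for e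
    using body_edges_src[OF that] by (simp add: accept_state_def)
qed

locale clocked_tm =
  fixes K :: nat and V U :: com and x :: nat
  assumes regs_V: "regs V \<subseteq> {..<K}" and regs_U: "regs U \<subseteq> {..<K}" and K: "3 < K"
begin

abbreviation "N \<equiv> read_state V U"

sublocale counter_tm K "prefix_instrs K N x" "body_edges V U"
  by (rule counter_tm_body)

lemma M_eq: "M = clocked_machine K V U x"
  by (simp add: M_def clocked_machine_def)

abbreviation input :: "nat list \<Rightarrow> tape \<Rightarrow> bool" where
  "input cs \<equiv> \<lambda>it. \<exists>l. it = (l, cs)"

lemma prefix_fst:
  assumes "i \<in> set (prefix_instrs K N x)" shows "fst i = 0 \<or> fst i > N"
  using assms by (auto simp: prefix_instrs_def start_instr_def chain_instr_def start_state_def)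

lemma prefix_step:
  assumes i: "(q, as, q') \<in> set (prefix_instrs K N x)" and as: "map fst as = map scan ts"
  shows "step M (q, ts) = (q', act as ts)"
  unfolding M_def
proof (rule step_instr)
  show "(q, as, q') \<in> set (prefix_instrs K N x @ edge_instrs K (body_edges V U))" using i by simp
  show "q \<noteq> accept_state"
    using prefix_fst[OF i] by (auto simp: accept_state_def read_state_def)
  fix as' q''
  assume "(q, as', q'') \<in> set (prefix_instrs K N x @ edge_instrs K (body_edges V U))"
  moreover have "(q, as', q'') \<notin> set (edge_instrs K (body_edges V U))"
    using X_E[OF i] by (auto simp: edge_instrs_def edge_instr_def)
  ultimately have "(q, as', q'') \<in> set (prefix_instrs K N x)" by simp
  then show "as' = as \<and> q'' = q'"
    using i by (auto simp: prefix_instrs_def start_instr_def chain_instr_def start_state_def read_state_def)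
qed (rule as)

lemma start_step:
  assumes "cs = 1 # cs'"
  shows "conf (\<lambda>it. it = ([], cs)) (N + x) ((\<lambda>_. 0)(2 := 1)) (step M (start_state, ([], cs) # replicate K ([], [])))"
proof -
  define as :: "(nat \<times> nat \<times> move) list" where "as = (1, 1, Stay) # map (\<lambda>j. (0, 3, if j = 2 then MoveRight else Stay)) [0..<K]"
  have "step M (start_state, ([], cs) # replicate K ([], [])) = (N + x, act as (([], cs) # replicate K ([], [])))"
    by (rule prefix_step)
       (auto simp: prefix_instrs_def start_instr_def as_def assms scan_def first_cell_def comp_def map_replicate_const)
  moreover have "counters K ((\<lambda>_. 0)(2 := 1)) (act (tl as) (replicate K ([], [])))"
    by (auto simp: counters_def as_def counter_def put_def first_cell_def intro: exI[of _ 0])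
  ultimately show ?thesis
    by (auto simp: conf_def as_def assms put_def)
qed

text \<open>Register \<open>2\<close> is positive and all others are zero throughout, so every chain
  state sees the same pattern and one instruction per state suffices. This is why register
  \<open>2\<close> starts at \<open>1\<close> and ends at \<open>x + 1\<close>.\<close>

lemma chain_run:
  assumes "i \<le> x" "v > 0" "conf (\<lambda>it. it = ([], 1 # cs)) (N + i) ((\<lambda>_. 0)(2 := v)) C"
  shows "conf (\<lambda>it. it = ([], 1 # cs)) N ((\<lambda>_. 0)(2 := v + i)) ((step M ^^ i) C)"
  using assms
proof (induction i arbitrary: v C)
  case (Suc i)
  define as :: "(nat \<times> nat \<times> move) list" where "as = (1, 1, Stay) # map (\<lambda>j. if j = 2 then (0, 0, MoveRight) else (3, 3, Stay)) [0..<K]"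
  obtain ts where C: "C = (N + Suc i, ([], 1 # cs) # ts)" and ts: "length ts = K"
      "\<And>j. j < K \<Longrightarrow> counter (((\<lambda>_. 0)(2 := v)) j) (ts ! j)"
    using Suc.prems(3) unfolding conf_def counters_def by blast
  have scan: "scan (ts ! j) = (if j = 2 then 0 else 3)" if "j < K" for j
    using counter_scan[OF ts(2)[OF that]] Suc.prems(2) by auto
  have "step M C = (N + i, act as (([], 1 # cs) # ts))"
    unfolding C
  proof (rule prefix_step)
    show "(N + Suc i, as, N + i) \<in> set (prefix_instrs K N x)"
      using Suc.prems(1) by (auto simp: prefix_instrs_def chain_instr_def as_def image_iff)
    show "map fst as = map scan (([], 1 # cs) # ts)"
      using ts scan by (auto simp: as_def scan_def[of "([], _)"] first_cell_def intro!: nth_equalityI)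
  qed
  moreover have "counters K ((\<lambda>_. 0)(2 := Suc v)) (act (tl as) ts)"
    unfolding counters_def
  proof (intro conjI allI impI)
    fix j assume j: "j < K"
    show "counter (((\<lambda>_. 0)(2 := Suc v)) j) (act (tl as) ts ! j)"
      using counter_move[OF ts(2)[OF j], of MoveRight] counter_move[OF ts(2)[OF j], of Stay] j ts scan[OF j]
      by (auto simp: as_def split: if_splits)
  qed (simp add: as_def ts)
  ultimately have "conf (\<lambda>it. it = ([], 1 # cs)) (N + i) ((\<lambda>_. 0)(2 := Suc v)) (step M C)"
    by (auto simp: conf_def as_def put_def fun_upd_def)
  then have "conf (\<lambda>it. it = ([], 1 # cs)) N ((\<lambda>_. 0)(2 := Suc v + i)) ((step M ^^ i) (step M C))"
    using Suc.prems(1) by (intro Suc.IH) (auto simp: fun_upd_def)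
  then show ?case by (simp add: funpow_swap1 fun_upd_def)
qed simp

lemma read_run:
  assumes "conf (input (replicate k 1 @ cs)) N \<sigma> C"
  shows "conf (input cs) N (\<sigma>(0 := \<sigma> 0 + k)) ((step M ^^ k) C)"
  using assms
proof (induction k arbitrary: \<sigma> C)
  case (Suc k)
  let ?e = "Edge N 1 MoveRight 0 MoveRight N MoveRight N"
  have "?e \<in> set (body_edges V U)" by (simp add: body_edges_def)
  moreover have "conf (\<lambda>it. scan it = edge.sym ?e \<and>
      input (replicate k 1 @ cs) (move_head (in_move ?e) (put (edge.sym ?e) it))) (src ?e) \<sigma> C"
    using Suc.prems by (auto simp: conf_def scan_def put_def first_cell_def)
  ultimately have "conf (input (replicate k 1 @ cs)) N (\<sigma>(0 := Suc (\<sigma> 0))) (step M C)"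
    using edge_step[of ?e "input (replicate k 1 @ cs)" \<sigma> C] K by (cases "\<sigma> 0 = 0") simp_all
  from Suc.IH[OF this] show ?case by (simp add: funpow_swap1 fun_upd_def cong: if_cong)
qed simp

definition clock :: "nat \<Rightarrow> tape \<Rightarrow> bool" where
  "clock k it \<longleftrightarrow> length (snd it) = k \<and> set (snd it) \<subseteq> {1, 2}"

lemma clock_Suc:
  "clock (Suc k) it \<Longrightarrow> scan it \<in> set [1, 2] \<and> clock k (move_head MoveRight (put (scan it) it))"
  by (cases it) (auto simp: clock_def scan_def put_def first_cell_def length_Suc_conv)

text \<open>An unlimited budget: staying in place preserves the scanned symbol, so the condition is
  the same for every \<open>k\<close>. The blank is included because the clocked phase may have
  consumed all of the padding.\<close>

definition letter :: "nat \<Rightarrow> tape \<Rightarrow> bool" where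
  "letter k it \<longleftrightarrow> scan it \<in> set [0, 1, 2]"

lemma letter_Suc:
  "letter (Suc k) it \<Longrightarrow> scan it \<in> set [0, 1, 2] \<and> letter k (move_head Stay (put (scan it) it))"
  by (cases it) (auto simp: letter_def scan_def put_def first_cell_def)

lemma clock_letter: "clock k it \<Longrightarrow> letter j it"
  by (cases it; cases "snd it") (auto simp: clock_def letter_def scan_def first_cell_def)

abbreviation init_regs :: "nat \<Rightarrow> nat \<Rightarrow> nat" where
  "init_regs s \<equiv> (\<lambda>_. 0)(2 := Suc x, 0 := Suc s)"

lemma conf_mono: "conf P q \<sigma> C \<Longrightarrow> (\<And>it. P it \<Longrightarrow> Q it) \<Longrightarrow> conf Q q \<sigma> C"
  unfolding conf_def by blast

lemma read_input:
  assumes "map (\<lambda>b. if b then 2 else 1) w = replicate (Suc k) 1 @ cs"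
  shows "conf (input cs) N ((\<lambda>_. 0)(2 := Suc x, 0 := Suc k)) (run M w (Suc (x + Suc k)))"
proof -
  let ?cs = "1 # replicate k 1 @ cs"
  have "start_config M w = (start_state, ([], ?cs) # replicate K ([], []))"
    using assms by (simp add: start_config_def M_def)
  then have "conf (\<lambda>it. it = ([], ?cs)) (N + x) ((\<lambda>_. 0)(2 := 1)) (run M w 1)"
    using start_step[of ?cs] by (simp add: run_def)
  then have "conf (\<lambda>it. it = ([], ?cs)) N ((\<lambda>_. 0)(2 := Suc x)) ((step M ^^ x) (run M w 1))"
    using chain_run[of x 1] by simp
  then have "conf (input (replicate (Suc k) 1 @ cs)) N ((\<lambda>_. 0)(2 := Suc x)) ((step M ^^ x) (run M w 1))"
    by (rule conf_mono) simp
  from read_run[OF this] show ?thesis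
    by (simp add: run_def funpow_swap1 funpow_add add.commute[of x])
qed

lemma separator_step:
  assumes "conf (input (2 # cs)) N \<sigma> C"
  shows "conf (input cs) 3 \<sigma> (step M C)"
proof -
  let ?e = "Edge N 2 MoveRight 0 Stay 3 Stay 3"
  have "?e \<in> set (body_edges V U)" by (simp add: body_edges_def)
  moreover have "conf (\<lambda>it. scan it = edge.sym ?e \<and>
      input cs (move_head (in_move ?e) (put (edge.sym ?e) it))) (src ?e) \<sigma> C"
    using assms by (auto simp: conf_def scan_def put_def first_cell_def)
  ultimately show ?thesis
    using edge_step[of ?e "input cs" \<sigma> C] K by (cases "\<sigma> 0 = 0") (simp_all add: fun_upd_idem)
qed

lemma run_add: "run M w (t + u) = (step M ^^ u) (run M w t)"
  by (simp add: run_def add.commute[of t] funpow_add)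

text \<open>One step writes the markers, \<open>x\<close> steps run through the chain,
  \<open>s + 1\<close> steps read the unary part and one reads the separator.\<close>

lemma clocked_start:
  "conf (clock (length v)) 3 (init_regs s) (run M (replicate (Suc s) False @ True # v) (x + s + 3))"
proof -
  let ?w = "replicate (Suc s) False @ True # v"
  let ?cs = "map (\<lambda>b. if b then 2 else 1) v :: nat list"
  have "conf (input (2 # ?cs)) N (init_regs s) (run M ?w (Suc (x + Suc s)))"
    by (rule read_input) simp
  then have "conf (input ?cs) 3 (init_regs s) (step M (run M ?w (Suc (x + Suc s))))"
    by (rule separator_step)
  also have "step M (run M ?w (Suc (x + Suc s))) = run M ?w (x + s + 3)"
    by (simp add: run_def numeral_3_eq_3)
  finally show ?thesis by (rule conf_mono) (auto simp: clock_def)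
qed

lemma V_edges: "set (compile [1, 2] MoveRight V 3 4 6) \<subseteq> set (body_edges V U)"
  and U_edges: "set (compile [0, 1, 2] Stay U 4 5 (6 + csize V)) \<subseteq> set (body_edges V U)"
  by (auto simp: body_edges_def)

lemma clock_expires:
  assumes "exec V (init_regs s) m \<tau>" "length v < m"
  shows "\<not> accepts_within M (replicate (Suc s) False @ True # v) T"
proof -
  let ?w = "replicate (Suc s) False @ True # v"
  have "stuck (run M ?w (x + s + 3))"
  proof (rule compile_stuck[where I = clock, OF clock_Suc _ _ _ _ assms(1) V_edges regs_V])
    show "scan it \<notin> set [1, 2]" if "clock 0 it" for it
      using that by (auto simp: clock_def scan_def first_cell_def)
    show "edge.sym e \<in> set [1, 2]"
      if "e \<in> set (body_edges V U)" "src e \<in> insert 3 {6..<6 + csize V}" for e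
      using that compile_src[of e "[1, 2]" MoveRight V 3 4 6]
        compile_src[of e "[0, 1, 2]" Stay U 4 5 "6 + csize V"]
      by (auto simp: body_edges_def read_state_def)
    show "fst i \<notin> insert 3 {6..<6 + csize V}" if "i \<in> set (prefix_instrs K N x)" for i
      using prefix_fst[OF that] by (auto simp: read_state_def)
    show "conf (clock (length v)) 3 (init_regs s) (run M ?w (x + s + 3))"
      by (rule clocked_start)
  qed (use assms(2) in \<open>auto simp: accept_state_def\<close>)
  then have "stuck (start_config M ?w)" unfolding run_def by (rule stuck_funpow)
  from stuck_never_accepts[OF this] show ?thesis
    by (simp add: accepts_within_def run_def)
qed

text \<open>The constant \<open>4\<close> is the \<open>3\<close> of \<open>clocked_start\<close>
  plus the final test of register \<open>3\<close>.\<close>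

lemma accepts_in_time:
  assumes V: "exec V (init_regs s) m \<tau>" and U: "exec U \<tau> p \<upsilon>" and m: "m \<le> length v"
  shows "accepts_within M (replicate (Suc s) False @ True # v) T \<longleftrightarrow>
    \<upsilon> 3 > 0 \<and> x + s + m + p + 4 \<le> T"
proof -
  let ?w = "replicate (Suc s) False @ True # v"
  obtain k where k: "length v = m + k" using m le_Suc_ex by blast
  have "conf (clock k) 4 \<tau> ((step M ^^ m) (run M ?w (x + s + 3)))"
    using clocked_start[of v s] unfolding k
    by (intro compile_run[where I = clock, OF _ V V_edges regs_V] clock_Suc)
  then have "conf (letter (p + 1)) 4 \<tau> ((step M ^^ m) (run M ?w (x + s + 3)))"
    by (rule conf_mono) (rule clock_letter)
  then have "conf (letter 1) 5 \<upsilon> ((step M ^^ p) ((step M ^^ m) (run M ?w (x + s + 3))))"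
    by (intro compile_run[where I = letter, OF _ U U_edges regs_U] letter_Suc)
  also have "(step M ^^ p) ((step M ^^ m) (run M ?w (x + s + 3))) = run M ?w (x + s + 3 + m + p)"
    by (simp only: run_add)
  finally have C: "conf (letter 1) 5 \<upsilon> (run M ?w (x + s + 3 + m + p))" .
  have "conf (letter 0) (if \<upsilon> 3 = 0 then 2 else 1)
      (\<upsilon>(3 := shift_by (if \<upsilon> 3 = 0 then Stay else Stay) (\<upsilon> 3)))
      (step M (run M ?w (x + s + 3 + m + p)))"
  proof (rule compile_edge_step[where I = letter and ins = "[0, 1, 2]" and mv = Stay])
    show "Edge 5 a Stay 3 Stay 2 Stay 1 \<in> set (body_edges V U)" if "a \<in> set [0, 1, 2]" for a
      using that by (auto simp: body_edges_def)
    show "conf (letter (Suc 0)) 5 \<upsilon> (run M ?w (x + s + 3 + m + p))" using C by simp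
  qed (use K letter_Suc in auto)
  then have D: "conf (\<lambda>_. True) (if \<upsilon> 3 = 0 then 2 else 1) \<upsilon> (step M (run M ?w (x + s + 3 + m + p)))"
    by (auto simp: conf_def)
  show ?thesis
  proof (cases "\<upsilon> 3 = 0")
    case True
    have "halted M (step M (run M ?w (x + s + 3 + m + p)))"
    proof (rule conf_halted[where P = "\<lambda>_. True"])
      show "\<not> True" if "e \<in> set (body_edges V U)" "src e = 2" for e
        using body_edges_src[OF that(1)] that(2) by simp
      show "fst i \<noteq> 2" if "i \<in> set (prefix_instrs K N x)" for i
        using prefix_fst[OF that] by (auto simp: read_state_def)
      show "conf (\<lambda>_. True) 2 \<upsilon> (step M (run M ?w (x + s + 3 + m + p)))" using D True by simp
    qed
    moreover have "fst (step M (run M ?w (x + s + 3 + m + p))) \<noteq> accept_state"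
      using D True by (auto simp: conf_def accept_state_def)
    ultimately have "stuck (step M (run M ?w (x + s + 3 + m + p)))"
      unfolding stuck_def by (intro exI[of _ 0]) simp
    then have "stuck (start_config M ?w)" unfolding run_def by (rule stuck_funpow[OF stuck_step])
    from stuck_never_accepts[OF this] True show ?thesis
      by (simp add: accepts_within_def run_def)
  next
    case False
    have S: "(step M ^^ Suc n) (start_config M ?w) = step M (run M ?w n)" for n
      by (simp add: run_def)
    have "fst ((step M ^^ T) (start_config M ?w)) = accept_state \<longleftrightarrow> Suc (x + s + 3 + m + p) \<le> T"
    proof (rule accepts_iff_time)
      show "fst ((step M ^^ (x + s + 3 + m + p)) (start_config M ?w)) \<noteq> accept_state"
        using C by (auto simp: conf_def run_def accept_state_def)
      show "fst ((step M ^^ Suc (x + s + 3 + m + p)) (start_config M ?w)) = accept_state"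
        unfolding S using D False by (auto simp: conf_def accept_state_def)
    qed
    then show ?thesis using False by (simp add: accepts_within_def run_def) linarith
  qed
qed

lemma read_stuck:
  assumes "conf (\<lambda>it. scan it = 0) N \<sigma> C"
  shows "stuck C"
proof -
  have "halted M C"
  proof (rule conf_halted[where P = "\<lambda>s. s = 0"])
    show "edge.sym e \<noteq> 0" if "e \<in> set (body_edges V U)" "src e = N" for e
      using that compile_src[of e "[1, 2]" MoveRight V 3 4 6]
        compile_src[of e "[0, 1, 2]" Stay U 4 5 "6 + csize V"]
      by (auto simp: body_edges_def read_state_def)
    show "fst i \<noteq> N" if "i \<in> set (prefix_instrs K N x)" for i
      using prefix_fst[OF that] by (auto simp: read_state_def)
  qed (rule assms)
  moreover have "fst C \<noteq> accept_state"
    using assms by (auto simp: conf_def read_state_def accept_state_def)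
  ultimately show ?thesis unfolding stuck_def by (intro exI[of _ 0]) simp
qed

lemma start_stuck:
  assumes "w = [] \<or> hd w"
  shows "stuck (start_config M w)"
proof -
  let ?cs = "map (\<lambda>b. if b then 2 else 1) w :: nat list"
  have "halted M (start_config M w)"
    unfolding M_def start_config_def
  proof (rule halted_no_instr)
    fix as q' assume "(start_state, as, q') \<in> set (prefix_instrs K N x @ edge_instrs K (body_edges V U))"
    moreover have "(start_state, as, q') \<notin> set (edge_instrs K (body_edges V U))"
      using body_edges_src by (fastforce simp: edge_instrs_def edge_instr_def start_state_def)
    ultimately have "(start_state, as, q') = start_instr K (N + x)"
      by (auto simp: prefix_instrs_def chain_instr_def start_state_def)
    then show "map fst as \<noteq> map scan (([], ?cs) # replicate (fst (K, prefix_instrs K N x @ edge_instrs K (body_edges V U))) ([], []))"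
      using assms by (cases w) (auto simp: start_instr_def scan_def first_cell_def)
  qed
  moreover have "fst (start_config M w) \<noteq> accept_state"
    by (simp add: start_config_def start_state_def accept_state_def)
  ultimately show ?thesis unfolding stuck_def by (intro exI[of _ 0]) simp
qed

text \<open>On the empty word or a word starting with \<open>True\<close> no first instruction
  applies, and a word of \<open>False\<close> only leads to a blank in the read state; in both cases
  the machine is stuck.\<close>

lemma accepts_form:
  assumes "accepts_within M w T"
  obtains s v where "w = replicate (Suc s) False @ True # v"
proof -
  have not_stuck: "\<not> stuck (start_config M w)"
    using assms stuck_never_accepts[of "start_config M w"] by (auto simp: accepts_within_def run_def)
  define k where "k = length (takeWhile Not w)"
  have "takeWhile Not w = replicate k False"
    unfolding k_def by (rule replicate_eqI) (auto dest: set_takeWhileD)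
  then have w: "w = replicate k False @ dropWhile Not w" by (metis takeWhile_dropWhile_id)
  have "w \<noteq> []" "\<not> hd w" using start_stuck not_stuck by blast+
  then obtain s where s: "k = Suc s" unfolding k_def by (cases w) auto
  show thesis
  proof (cases "dropWhile Not w")
    case Nil
    have "w = replicate (Suc s) False" using w[unfolded Nil] s by auto
    then have "conf (input []) N (init_regs s) (run M w (Suc (x + Suc s)))"
      by (intro read_input) simp
    then have "conf (\<lambda>it. scan it = 0) N (init_regs s) (run M w (Suc (x + Suc s)))"
      by (rule conf_mono) (auto simp: scan_def first_cell_def)
    then have "stuck (run M w (Suc (x + Suc s)))" by (rule read_stuck)
    then have "stuck (start_config M w)" unfolding run_def by (rule stuck_funpow)
    with not_stuck show ?thesis ..
  next
    case (Cons b v)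
    then have b using hd_dropWhile[of Not w] by simp
    then show ?thesis using that[of s v] w s Cons by simp
  qed
qed

end

section \<open>A family of polynomial time sets\<close>

lemma compu_enc: "compu f \<Longrightarrow> compu (\<lambda>x. enc (f x))"
  by (erule compu_lift1[where \<phi> = "\<lambda>n. n"]) auto

lemma compu_upt [compu_intros]:
  assumes "compu n" shows "compu (\<lambda>x. [0..<n x])"
proof -
  have eq: "[0..<m] = rec_nat [] (\<lambda>k r. r @ [k]) m" for m by (induction m) auto
  show ?thesis unfolding eq by (intro compu_intros assms)
qed

text \<open>Decoding is not injective, but \<open>enc\<close> is a right inverse of it, so computing
  a machine also computes an index for it.\<close>

lemma machine_decode_enc: "machine_decode (enc M) = M"
proof -
  have m: "move_decode (enc d) = d" for d by (cases d) (simp_all add: move_decode_def enc_move_def)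
  have a: "action_decode (enc p) = p" for p :: "nat \<times> nat \<times> move"
    by (cases p) (simp add: action_decode_def enc_prod_def m)
  have i: "instr_decode (enc i) = i" for i :: instr
  proof (cases i)
    case (fields q as q')
    have "enc i = prod_encode (q, prod_encode (list_encode (map enc as), q'))"
      by (simp add: fields enc_prod_def enc_list_def)
    then show ?thesis by (simp add: fields instr_decode_def comp_def a)
  qed
  have "enc M = prod_encode (fst M, list_encode (map enc (snd M)))"
    by (simp add: enc_prod_def enc_list_def)
  then show ?thesis by (simp add: machine_decode_def comp_def i)
qed

lemma compu_clocked_machine: "compu f \<Longrightarrow> compu (\<lambda>x. clocked_machine K V U (f x))"
proof -
  have "compu (\<lambda>x. clocked_machine K V U x)"
    unfolding clocked_machine_def prefix_instrs_def start_instr_def chain_instr_def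
    by (intro compu_intros)
  then show "compu f \<Longrightarrow> ?thesis" by (rule compu_compose)
qed

abbreviation word :: "nat \<Rightarrow> bool list \<Rightarrow> bool list" where
  "word s v \<equiv> replicate (Suc s) False @ True # v"

lemma word_eq_iff: "word s v = word s' v' \<longleftrightarrow> s = s' \<and> v = v'"
proof -
  have "length (takeWhile Not (word i u)) = Suc i" "dropWhile Not (word i u) = True # u" for i u
    by (induction i) auto
  then show ?thesis by (metis list.inject nat.inject)
qed

text \<open>
  Renaming registers so that register \<open>2\<close>, which holds \<open>x + 1\<close>, is untouched makes the running time
  of the clocked phase independent of \<open>x\<close>.
\<close>

primrec avoid2 :: "com \<Rightarrow> com" where
  "avoid2 (Inc r) = Inc (if r < 2 then r else Suc r)"
| "avoid2 (Dec r) = Dec (if r < 2 then r else Suc r)"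
| "avoid2 (Seq c d) = Seq (avoid2 c) (avoid2 d)"
| "avoid2 (While r c) = While (if r < 2 then r else Suc r) (avoid2 c)"

definition insert2 :: "nat \<Rightarrow> (nat \<Rightarrow> nat) \<Rightarrow> nat \<Rightarrow> nat" where
  "insert2 k \<sigma> = (\<lambda>r. if r < 2 then \<sigma> r else if r = 2 then k else \<sigma> (r - 1))"

lemma exec_avoid2: "exec c \<sigma> n \<tau> \<Longrightarrow> exec (avoid2 c) (insert2 k \<sigma>) n (insert2 k \<tau>)"
proof (induction rule: exec.induct)
  case (Inc r \<sigma>)
  have "insert2 k (\<sigma>(r := Suc (\<sigma> r))) = (insert2 k \<sigma>)((if r < 2 then r else Suc r) :=
      Suc (insert2 k \<sigma> (if r < 2 then r else Suc r)))"
    by (auto simp: insert2_def fun_eq_iff)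
  then show ?case using exec.Inc[of "if r < 2 then r else Suc r" "insert2 k \<sigma>"]
    by (cases "r < 2") (simp_all add: fun_upd_def)
next
  case (Dec r \<sigma>)
  have "insert2 k (\<sigma>(r := \<sigma> r - 1)) = (insert2 k \<sigma>)((if r < 2 then r else Suc r) :=
      insert2 k \<sigma> (if r < 2 then r else Suc r) - 1)"
    by (auto simp: insert2_def fun_eq_iff)
  then show ?case using exec.Dec[of "if r < 2 then r else Suc r" "insert2 k \<sigma>"]
    by (cases "r < 2") (simp_all add: fun_upd_def)
next
  case (While_zero \<sigma> r c)
  then have "insert2 k \<sigma> (if r < 2 then r else Suc r) = 0" by (auto simp: insert2_def)
  then show ?case
    using exec.While_zero[of "insert2 k \<sigma>" "if r < 2 then r else Suc r" "avoid2 c"] by simp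
next
  case (While_pos \<sigma> r c m \<tau> n \<upsilon>)
  have "insert2 k \<sigma> (if r < 2 then r else Suc r) > 0" using While_pos.hyps by (auto simp: insert2_def)
  from exec.While_pos[OF this While_pos.IH(1)] While_pos.IH(2) show ?case by simp
qed (auto intro: exec.intros)

lemma ex_register_bound: "\<exists>K>3. regs c \<subseteq> {..<K} \<and> regs d \<subseteq> {..<K}"
proof -
  have "finite (regs c \<union> regs d)" by (simp add: finite_regs)
  then obtain B where "\<forall>r\<in>regs c \<union> regs d. r < B" using finite_nat_set_iff_bounded by blast
  then have "regs c \<union> regs d \<subseteq> {..<B + 4}" by (auto intro: trans_less_add1)
  then show ?thesis by (intro exI[of _ "B + 4"]) simp
qed

lemma compu_implements:
  assumes "compu (\<lambda>p. F (fst p) (snd p) :: nat)" "a < b" "a' < b" "out < b" "out \<noteq> a" "out \<noteq> a'"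
  obtains c where "implements c (\<lambda>xs. F (xs ! 0) (xs ! 1)) [a, a'] out b"
proof -
  have "compu (\<lambda>n. F (fst (prod_decode n)) (snd (prod_decode n)))"
    using compu_compose[OF assms(1), of "\<lambda>n. prod_decode n"] by (simp add: compu_intros)
  then have "computable (\<lambda>n. F (fst (prod_decode n)) (snd (prod_decode n)))"
    by (simp only: compu_iff_computable)
  from rec_fun_computable[OF this rec_fun_prod_encode[OF rec_fun_nth rec_fun_nth, of 0 2 1]]
  have "rec_fun 2 (\<lambda>xs. F (xs ! 0) (xs ! 1))" by simp
  then obtain G where G: "recursive 2 G" "\<And>xs. length xs = 2 \<Longrightarrow> F (xs ! 0) (xs ! 1) = G xs"
    unfolding rec_fun_def by auto
  have "implementable 2 G" using G(1) by (rule recursive_implementable)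
  moreover have "length [a, a'] = 2" "\<forall>x\<in>set [a, a']. x < b" "out \<notin> set [a, a']"
    using assms by auto
  ultimately obtain c where "implements c G [a, a'] out b"
    using assms(4) unfolding implementable_def by blast
  moreover have "G [k, l] = F k l" for k l using G(2)[of "[k, l]"] by simp
  ultimately have "implements c (\<lambda>xs. F (xs ! 0) (xs ! 1)) [a, a'] out b"
    by (simp add: implements_def)
  then show ?thesis by (rule that)
qed

lemma ptime_subset_family:
  assumes u: "compu (\<lambda>p :: nat \<times> nat. u (fst p) (snd p))"
  shows "\<exists>f. compu f \<and> (\<forall>x y. ptime_set (f x) \<subseteq> ptime_set (f y) \<longleftrightarrow> (\<forall>s. u x s \<longrightarrow> u y s))"
proof -
  \<comment> \<open>The registers on entry to the clocked phase. Both inputs are stored increased by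
    one, which explains the subtractions in the specification of \<open>U\<close>.\<close>
  define \<rho> :: "nat \<Rightarrow> nat \<Rightarrow> nat \<Rightarrow> nat" where "\<rho> x s = (\<lambda>_. 0)(2 := Suc x, 0 := Suc s)" for x s
  have "compu (\<lambda>p :: nat \<times> nat. (if u (fst p - 1) (snd p - 1) then 1 else 0) :: nat)"
    using compu_compose[OF u, of "\<lambda>p. (fst p - 1, snd p - 1)"] by (intro compu_intros) (simp add: compu_intros)
  then obtain U where U: "implements U (\<lambda>xs. (if u (xs ! 0 - 1) (xs ! 1 - 1) then 1 else 0)) [2, 0] 3 4"
    by (rule compu_implements[where a = 2 and a' = 0 and out = 3 and b = 4 and F = "\<lambda>x s. if u (x - 1) (s - 1) then 1 else 0"]) auto
  have "runs U (\<rho> x s) ((\<rho> x s)(3 := (if u x s then 1 else 0)))" for x s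
    using implementsD[OF U, of "\<rho> x s"] by (simp add: \<rho>_def)
  then have "\<exists>p. \<forall>x s. exec U (\<rho> x s) (p x s) ((\<rho> x s)(3 := (if u x s then 1 else 0)))"
    unfolding runs_def by metis
  then obtain p where p: "\<And>x s. exec U (\<rho> x s) (p x s) ((\<rho> x s)(3 := (if u x s then 1 else 0)))" by blast

  \<comment> \<open>The same machine with a trivial clocked phase and unconditional acceptance; its acceptance
    time bounds the time \<open>p x s\<close> of \<open>U\<close> and is computable.\<close>
  define V' where "V' = Seq (Inc 1) (Dec 1)"
  define U' where "U' = Seq U (Inc 3)"
  obtain K' where K': "K' > 3" "regs V' \<subseteq> {..<K'}" "regs U' \<subseteq> {..<K'}" using ex_register_bound by blast
  have V': "exec V' (\<rho> x s) 2 (\<rho> x s)" for x s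
  proof -
    let ?\<sigma> = "(\<rho> x s)(1 := Suc (\<rho> x s 1))"
    have "exec V' (\<rho> x s) (1 + 1) (?\<sigma>(1 := ?\<sigma> 1 - 1))"
      unfolding V'_def by (rule exec.Seq[OF exec.Inc exec.Dec])
    moreover have "?\<sigma>(1 := ?\<sigma> 1 - 1) = \<rho> x s" by (auto simp: fun_eq_iff \<rho>_def)
    ultimately show ?thesis by (simp only: one_add_one)
  qed
  have U': "exec U' (\<rho> x s) (p x s + 1) ((\<rho> x s)(3 := Suc (if u x s then 1 else 0)))" for x s
    using exec.Seq[OF p[of x s] exec.Inc[of 3]] by (simp add: U'_def)
  \<comment> \<open>The final \<open>Inc 3\<close> forces acceptance. The \<open>7\<close> consists
    of the \<open>4\<close> of \<open>accepts_in_time\<close>, two steps of \<open>V'\<close>, paid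
    for by the padding \<open>[True, True]\<close>, and that \<open>Inc 3\<close>.\<close>
  have time': "accepts_within (clocked_machine K' V' U' x) (word s [True, True]) T \<longleftrightarrow> x + s + p x s + 7 \<le> T"
    for x s T
  proof -
    interpret clocked_tm K' V' U' x by unfold_locales (use K' in auto)
    show ?thesis
      unfolding M_eq[symmetric]
      using accepts_in_time[OF V'[of x s, unfolded \<rho>_def] U'[of x s, unfolded \<rho>_def],
          where v = "[True, True]" and T = T] by (simp add: ac_simps)
  qed
  define time where "time n = (LEAST T. accepts_within (clocked_machine K' V' U' (fst (prod_decode n)))
      (word (snd (prod_decode n)) [True, True]) T)" for n
  have compu_time: "compu time"
    unfolding time_def by (intro compu_intros compu_clocked_machine) (auto simp: time' simp del: append_Cons replicate_Suc)
  have time: "p x s \<le> time (prod_encode (x, s))" for x s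
  proof -
    have "accepts_within (clocked_machine K' V' U' x) (word s [True, True]) = (\<lambda>T. x + s + p x s + 7 \<le> T)"
      by (rule ext) (rule time')
    then have "time (prod_encode (x, s)) = (LEAST T. x + s + p x s + 7 \<le> T)"
      unfolding time_def by (simp only: prod_encode_inverse fst_conv snd_conv)
    also have "\<dots> = x + s + p x s + 7" by (rule Least_equality) auto
    finally show ?thesis by simp
  qed

  \<comment> \<open>Writing the value of \<open>g\<close> into a counter takes at least that many steps, so passing the clocked
    phase on \<open>word s v\<close> forces \<open>length v\<close> to dominate \<open>p x s\<close> for all \<open>x \<le> s\<close>.  The finitely many
    \<open>s < x\<close> are absorbed by the additive constant of the clock \<open>c\<close>.\<close>
  define g where "g k = (\<Sum>x<k. time (prod_encode (x, k - 1)))" for k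
  have "compu (\<lambda>p. time (prod_encode (snd p, fst p - 1)))"
    by (intro compu_compose[OF compu_time] compu_intros)
  then have "compu g" unfolding g_def by (intro compu_intros)
  have "compu (\<lambda>p :: nat \<times> nat. g (fst p))"
    by (intro compu_compose[OF \<open>compu g\<close>] compu_intros)
  then obtain V0 where V0: "implements V0 (\<lambda>xs. g (xs ! 0)) [0, 0] 1 2"
    by (rule compu_implements[where a = 0 and a' = 0 and out = 1 and b = 2 and F = "\<lambda>k _. g k"]) auto
  \<comment> \<open>Clearing register \<open>1\<close> restores the registers that \<open>U\<close>
    expects. \<open>avoid2\<close> moves the scratch space, which starts at \<open>2\<close>, above
    the register holding \<open>x + 1\<close>.\<close>
  define V where "V = avoid2 (Seq V0 (clear 1))"
  have "\<exists>n \<ge> g (Suc s). \<forall>x. exec V (\<rho> x s) n (\<rho> x s)" for s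
  proof -
    let ?\<sigma> = "(\<lambda>_. 0)(0 := Suc s) :: nat \<Rightarrow> nat"
    have "runs V0 ?\<sigma> (?\<sigma>(1 := g (Suc s)))"
      using implementsD[OF V0, of ?\<sigma>] by simp
    then obtain n where n: "exec V0 ?\<sigma> n (?\<sigma>(1 := g (Suc s)))" unfolding runs_def by blast
    obtain l where l: "exec (clear 1) (?\<sigma>(1 := g (Suc s))) l ((?\<sigma>(1 := g (Suc s)))(1 := 0))"
      using runs_clear unfolding runs_def by blast
    have "(?\<sigma>(1 := g (Suc s)))(1 := 0) = ?\<sigma>" by (auto simp: fun_eq_iff)
    then have "exec (Seq V0 (clear 1)) ?\<sigma> (n + l) ?\<sigma>" using exec.Seq[OF n l] by simp
    moreover have "insert2 (Suc x) ?\<sigma> = \<rho> x s" for x by (auto simp: insert2_def \<rho>_def fun_eq_iff)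
    ultimately have "exec V (\<rho> x s) (n + l) (\<rho> x s)" for x
      using exec_avoid2[of "Seq V0 (clear 1)" ?\<sigma> "n + l" ?\<sigma> "Suc x"] by (simp add: V_def)
    moreover have "g (Suc s) \<le> n + l" using exec_register_le[OF n, of 1] by simp
    ultimately show ?thesis by blast
  qed
  then obtain m where m: "\<And>s. g (Suc s) \<le> m s" "\<And>x s. exec V (\<rho> x s) (m s) (\<rho> x s)" by metis

  obtain K where K: "K > 3" "regs V \<subseteq> {..<K}" "regs U \<subseteq> {..<K}" using ex_register_bound by blast
  \<comment> \<open>\<open>x + 4\<close> pays for the chain and the fixed steps and makes the
    exponent at least \<open>2\<close>; the sum pays for \<open>U\<close> at the pairs with
    \<open>s < x\<close>.\<close>
  define c where "c x = x + 4 + (\<Sum>s<x. time (prod_encode (x, s)))" for x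
  define f where "f x = prod_encode (enc (clocked_machine K V U x), c x)" for x
  have "compu (\<lambda>p. time (prod_encode (fst p, snd p)))"
    by (intro compu_compose[OF compu_time] compu_intros)
  then have "compu c" unfolding c_def by (intro compu_intros)
  then have "compu f" unfolding f_def by (intro compu_intros compu_enc compu_clocked_machine)

  have f: "ptime_set (f x) = {w. \<exists>s v. w = word s v \<and> m s \<le> length v \<and> u x s}" for x
  proof -
    interpret clocked_tm K V U x by unfold_locales (use K in auto)
    have bound: "x + s + m s + p x s + 4 \<le> length (word s v) ^ c x + c x" if v: "m s \<le> length v" for s v
    proof -
      define l where "l = length (word s v)"
      have l: "l = s + 2 + length v" by (simp add: l_def)
      have c: "c x \<ge> 2" by (simp add: c_def)
      \<comment> \<open>Two word lengths are needed: one bounds \<open>s + m s\<close>, the other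
        bounds \<open>p x s\<close> when \<open>x \<le> s\<close>.\<close>
      have "l ^ 2 \<le> l ^ c x" using c l by (intro power_increasing) auto
      moreover have "2 * l \<le> l ^ 2" using l by (simp add: power2_eq_square)
      ultimately have ll: "2 * l \<le> l ^ c x" by linarith
      show ?thesis
      proof (cases "x \<le> s")
        case True
        have "time (prod_encode (x, s)) \<le> g (Suc s)"
          unfolding g_def diff_Suc_1 using True
          by (intro member_le_sum[where f = "\<lambda>x. time (prod_encode (x, s))"]) auto
        then have "p x s \<le> length v" using time[of x s] m(1)[of s] v by linarith
        then show ?thesis unfolding l_def[symmetric] using ll l v by (simp add: c_def)
      next
        case False
        then have "time (prod_encode (x, s)) \<le> (\<Sum>s<x. time (prod_encode (x, s)))"
          by (intro member_le_sum[where f = "\<lambda>s. time (prod_encode (x, s))"]) auto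
        then show ?thesis unfolding l_def[symmetric] using time[of x s] ll l v by (simp add: c_def)
      qed
    qed
    have acc: "accepts_within M (word s v) (length (word s v) ^ c x + c x) \<longleftrightarrow> m s \<le> length v \<and> u x s" for s v
    proof (cases "m s \<le> length v")
      case True
      have "accepts_within M (word s v) T \<longleftrightarrow> u x s \<and> x + s + m s + p x s + 4 \<le> T" for T
        using accepts_in_time[OF m(2)[unfolded \<rho>_def] p[of x s, unfolded \<rho>_def] True, of T] by auto
      then show ?thesis using bound[OF True] True by blast
    next
      case False
      then have "\<not> accepts_within M (word s v) T" for T
        using clock_expires[OF m(2)[unfolded \<rho>_def], of v] by simp
      then show ?thesis using False by blast
    qed
    have w: "w \<in> ptime_set (f x) \<longleftrightarrow> accepts_within M w (length w ^ c x + c x)" for w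
      by (simp add: ptime_set_def f_def machine_decode_enc M_eq)
    show ?thesis
    proof (intro set_eqI iffI)
      fix w assume "w \<in> ptime_set (f x)"
      then have a: "accepts_within M w (length w ^ c x + c x)" by (simp only: w)
      then obtain s v where e: "w = word s v" by (rule accepts_form)
      have "m s \<le> length v \<and> u x s" using a unfolding e by (simp only: acc)
      then show "w \<in> {w. \<exists>s v. w = word s v \<and> m s \<le> length v \<and> u x s}" using e by blast
    next
      fix w assume "w \<in> {w. \<exists>s v. w = word s v \<and> m s \<le> length v \<and> u x s}"
      then obtain s v where e: "w = word s v" and "m s \<le> length v \<and> u x s" by blast
      then show "w \<in> ptime_set (f x)" unfolding w e by (simp only: acc)
    qed
  qed
  have "ptime_set (f x) \<subseteq> ptime_set (f y) \<longleftrightarrow> (\<forall>s. u x s \<longrightarrow> u y s)" for x y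
  proof
    assume sub: "ptime_set (f x) \<subseteq> ptime_set (f y)"
    show "\<forall>s. u x s \<longrightarrow> u y s"
    proof (intro allI impI)
      fix s assume "u x s"
      \<comment> \<open>The shortest admissible padding gives a word testing exactly whether
        \<open>s\<close> belongs to the set.\<close>
      then have "word s (replicate (m s) True) \<in> ptime_set (f x)" unfolding f by force
      then have "word s (replicate (m s) True) \<in> ptime_set (f y)" using sub by blast
      then show "u y s" unfolding f by (auto simp only: mem_Collect_eq word_eq_iff)
    qed
  next
    assume "\<forall>s. u x s \<longrightarrow> u y s"
    then show "ptime_set (f x) \<subseteq> ptime_set (f y)" unfolding f by blast
  qed
  with \<open>compu f\<close> show ?thesis by blast
qed

section \<open>Upward closed sets of a preorder\<close>

locale pi01_preorder =
  fixes P :: "(nat \<times> nat) set" and h :: "nat \<Rightarrow> nat"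
  assumes refl: "(x, x) \<in> P"
    and trans: "(x, y) \<in> P \<Longrightarrow> (y, z) \<in> P \<Longrightarrow> (x, z) \<in> P"
    and h_compu: "compu h"
    and h_range: "range h = prod_encode ` (- P)"
begin

definition refuted :: "nat \<Rightarrow> nat \<Rightarrow> nat \<Rightarrow> bool" where
  "refuted T i j \<longleftrightarrow> (\<exists>k<T. h k = prod_encode (i, j))"

lemma refuted_not_in: "refuted T i j \<Longrightarrow> (i, j) \<notin> P"
proof -
  assume "refuted T i j"
  then obtain k where "h k = prod_encode (i, j)" unfolding refuted_def by blast
  then have "prod_encode (i, j) \<in> prod_encode ` (- P)" using h_range by (metis rangeI)
  then show "(i, j) \<notin> P" by (auto dest: injD[OF inj_prod_encode])
qed

lemma eventually_refuted: "(i, j) \<notin> P \<Longrightarrow> \<exists>T. refuted T i j"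
proof -
  assume "(i, j) \<notin> P"
  then have "prod_encode (i, j) \<in> range h" unfolding h_range by blast
  then show ?thesis unfolding refuted_def by (metis imageE lessI)
qed

lemma refuted_mono: "refuted T i j \<Longrightarrow> T \<le> T' \<Longrightarrow> refuted T' i j"
  unfolding refuted_def by (meson less_le_trans)

lemma all_refuted:
  assumes "finite A" "\<And>p. p \<in> A \<Longrightarrow> p \<notin> P"
  shows "\<exists>T. \<forall>p\<in>A. refuted T (fst p) (snd p)"
  using assms
proof (induction A rule: finite_induct)
  case (insert p A)
  then obtain T where T: "\<forall>p\<in>A. refuted T (fst p) (snd p)" by blast
  obtain T' where "refuted T' (fst p) (snd p)"
    using eventually_refuted[of "fst p" "snd p"] insert.prems by auto
  then have "\<forall>q\<in>insert p A. refuted (max T T') (fst q) (snd q)"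
    using T by (auto intro: refuted_mono)
  then show ?case by blast
qed simp

text \<open>
  A list \<open>L\<close> of flagged numbers is a partial upward closed set: flag \<open>True\<close> puts a number inside,
  flag \<open>False\<close> outside.  The next number \<open>n\<close> may be put inside once no outside element can be
  above it, and outside once no inside element can be below it.  By transitivity one of
  the two is confirmed eventually.
\<close>

definition safe_in :: "nat \<Rightarrow> nat \<Rightarrow> (nat \<times> bool) list \<Rightarrow> bool" where
  "safe_in T n L \<longleftrightarrow> list_all (\<lambda>p. snd p \<or> refuted T n (fst p)) L"

definition safe_out :: "nat \<Rightarrow> nat \<Rightarrow> (nat \<times> bool) list \<Rightarrow> bool" where
  "safe_out T n L \<longleftrightarrow> list_all (\<lambda>p. \<not> snd p \<or> refuted T (fst p) n) L"

text \<open>The two seeds are not entered in turn, so \<open>length L - 2\<close> is the next number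
  to decide. \<open>T\<close> is at once the number of rounds and the bound on the enumeration, so
  an undecided number is retried with more information. The seeds get a second entry when their turn
  comes.\<close>

definition stage :: "nat \<Rightarrow> nat \<Rightarrow> (nat \<times> bool) list" where
  "stage s T = rec_nat [(fst (prod_decode (h s)), True), (snd (prod_decode (h s)), False)]
     (\<lambda>T L. if safe_in T (length L - 2) L then (length L - 2, True) # L
            else if safe_out T (length L - 2) L then (length L - 2, False) # L else L) T"

lemma stage_0: "stage s 0 = [(fst (prod_decode (h s)), True), (snd (prod_decode (h s)), False)]"
  by (simp add: stage_def)

lemma stage_Suc: "stage s (Suc T) =
    (if safe_in T (length (stage s T) - 2) (stage s T) then (length (stage s T) - 2, True) # stage s T
     else if safe_out T (length (stage s T) - 2) (stage s T) then (length (stage s T) - 2, False) # stage s T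
     else stage s T)"
  by (simp add: stage_def)

lemma length_stage: "2 \<le> length (stage s T)"
  by (induction T) (auto simp: stage_0 stage_Suc)

lemma stage_mono: "T \<le> T' \<Longrightarrow> set (stage s T) \<subseteq> set (stage s T')"
  by (induction T' rule: dec_induct) (auto simp: stage_Suc)

text \<open>The seeds form an enumerated pair of the complement of \<open>P\<close>, and each later
  entry is made only after every conflicting comparison with earlier ones has been refuted.\<close>

lemma stage_consistent:
  "(u, True) \<in> set (stage s T) \<Longrightarrow> (v, False) \<in> set (stage s T) \<Longrightarrow> (u, v) \<notin> P"
proof (induction T arbitrary: u v)
  case 0
  have "h s \<in> prod_encode ` (- P)" using h_range by blast
  then have "prod_decode (h s) \<notin> P" by auto
  with 0 show ?case by (auto simp: stage_0)
next
  case (Suc T)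
  let ?n = "length (stage s T) - 2"
  consider "stage s (Suc T) = (?n, True) # stage s T" "safe_in T ?n (stage s T)"
    | "stage s (Suc T) = (?n, False) # stage s T" "safe_out T ?n (stage s T)"
    | "stage s (Suc T) = stage s T"
    by (cases "safe_in T ?n (stage s T)"; cases "safe_out T ?n (stage s T)") (auto simp: stage_Suc)
  then show ?case
  proof cases
    case 1
    then have "(?n, w) \<notin> P" if "(w, False) \<in> set (stage s T)" for w
      using that by (auto simp: safe_in_def list_all_iff dest!: bspec[OF _ that] refuted_not_in)
    then show ?thesis using Suc 1(1) by auto
  next
    case 2
    then have "(w, ?n) \<notin> P" if "(w, True) \<in> set (stage s T)" for w
      using that by (auto simp: safe_out_def list_all_iff dest!: bspec[OF _ that] refuted_not_in)
    then show ?thesis using Suc 2(1) by auto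
  next
    case 3
    then show ?thesis using Suc by simp
  qed
qed

lemma stage_covers: "n < length (stage s T) - 2 \<Longrightarrow> \<exists>b. (n, b) \<in> set (stage s T)"
proof (induction T)
  case (Suc T)
  then show ?case using length_stage[of s T]
    by (cases "n < length (stage s T) - 2") (auto simp: stage_Suc split: if_splits)
qed (simp add: stage_0)

text \<open>The list is frozen at \<open>T1\<close> while the enumeration bound grows. If
  \<open>n\<close> is below an outside \<open>v\<close>, an inside \<open>u\<close> below
  \<open>n\<close> would be below \<open>v\<close>, against consistency. The distinction need not be
  decidable, since the construction merely waits.\<close>

lemma eventually_safe: "\<exists>T0. \<forall>T\<ge>T0. safe_in T n (stage s T1) \<or> safe_out T n (stage s T1)"
proof (cases "\<exists>v. (v, False) \<in> set (stage s T1) \<and> (n, v) \<in> P")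
  case False
  then have "\<exists>T0. \<forall>p\<in>(\<lambda>q. (n, fst q)) ` {q \<in> set (stage s T1). \<not> snd q}. refuted T0 (fst p) (snd p)"
    by (intro all_refuted) auto
  then obtain T0 where T0: "\<forall>p\<in>(\<lambda>q. (n, fst q)) ` {q \<in> set (stage s T1). \<not> snd q}. refuted T0 (fst p) (snd p)"
    by blast
  have "\<forall>q\<in>set (stage s T1). snd q \<or> refuted T0 n (fst q)" using T0 by force
  then have "safe_in T n (stage s T1)" if "T0 \<le> T" for T
    using that by (auto simp: safe_in_def list_all_iff intro: refuted_mono)
  then show ?thesis by blast
next
  case True
  then have "(u, n) \<notin> P" if "(u, True) \<in> set (stage s T1)" for u
    using stage_consistent[OF that] trans by blast
  then have "\<exists>T0. \<forall>p\<in>(\<lambda>q. (fst q, n)) ` {q \<in> set (stage s T1). snd q}. refuted T0 (fst p) (snd p)"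
    by (intro all_refuted) auto
  then obtain T0 where T0: "\<forall>p\<in>(\<lambda>q. (fst q, n)) ` {q \<in> set (stage s T1). snd q}. refuted T0 (fst p) (snd p)"
    by blast
  have "\<forall>q\<in>set (stage s T1). \<not> snd q \<or> refuted T0 (fst q) n" using T0 by force
  then have "safe_out T n (stage s T1)" if "T0 \<le> T" for T
    using that by (auto simp: safe_out_def list_all_iff intro: refuted_mono)
  then show ?thesis by blast
qed

text \<open>A list that never grew again would be constant, and then one of the two answers for the
  pending number would be confirmed and entered.\<close>

lemma stage_unbounded: "\<exists>T. n + 2 \<le> length (stage s T)"
proof (induction n)
  case 0
  show ?case using length_stage[of s 0] by (intro exI[of _ 0]) simp
next
  case (Suc n)
  then obtain T1 where T1: "n + 2 \<le> length (stage s T1)" by blast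
  obtain T0 where T0: "\<And>T. T \<ge> T0 \<Longrightarrow>
      safe_in T (length (stage s T1) - 2) (stage s T1) \<or> safe_out T (length (stage s T1) - 2) (stage s T1)"
    using eventually_safe by blast
  have "\<exists>T. length (stage s T1) < length (stage s T)"
  proof (rule ccontr)
    assume "\<not> ?thesis"
    then have le: "length (stage s T) \<le> length (stage s T1)" for T by (simp add: not_less)
    have eq: "stage s T = stage s T1" if "T1 \<le> T" for T
      using that
    proof (induction T rule: dec_induct)
      case (step T)
      then show ?case using le[of "Suc T"] by (auto simp: stage_Suc split: if_splits)
    qed simp
    have "length (stage s (Suc (max T0 T1))) = Suc (length (stage s T1))"
      using T0[of "max T0 T1"] eq[of "max T0 T1"] by (auto simp: stage_Suc)
    then show False using le[of "Suc (max T0 T1)"] by simp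
  qed
  then obtain T where "length (stage s T1) < length (stage s T)" by blast
  with T1 show ?case by (intro exI[of _ T]) simp
qed

text \<open>At length \<open>x + 3\<close>, seeds included, the numbers \<open>0\<close> to
  \<open>x\<close> have been decided.\<close>

definition member :: "nat \<Rightarrow> nat \<Rightarrow> bool" where
  "member x s \<longleftrightarrow> (x, True) \<in> set (stage s (LEAST T. x + 3 \<le> length (stage s T)))"

lemma stage_covers_Least: "\<exists>b. (x, b) \<in> set (stage s (LEAST T. x + 3 \<le> length (stage s T)))"
proof -
  have "\<exists>T. x + 3 \<le> length (stage s T)"
    using stage_unbounded[of "Suc x" s] by (simp add: eval_nat_numeral)
  then have "x + 3 \<le> length (stage s (LEAST T. x + 3 \<le> length (stage s T)))" by (rule LeastI_ex)
  then have "x < length (stage s (LEAST T. x + 3 \<le> length (stage s T))) - 2" by linarith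
  then show ?thesis by (rule stage_covers)
qed

text \<open>Two different flags for \<open>x\<close> at a common later stage would give
  \<open>(x, x) \<notin> P\<close> by consistency, against reflexivity. In particular the second
  entry of a seed agrees with the first.\<close>

lemma not_both: "(x, True) \<in> set (stage s T) \<Longrightarrow> (x, False) \<notin> set (stage s T')"
  using stage_mono[of T "max T T'" s] stage_mono[of T' "max T T'" s] stage_consistent[of x s "max T T'" x] refl
  by auto

lemma member_iff: "member x s \<longleftrightarrow> (\<exists>T. (x, True) \<in> set (stage s T))"
  unfolding member_def using stage_covers_Least[of x s] not_both by (metis (full_types))

lemma member_upward: "(x, y) \<in> P \<Longrightarrow> member x s \<Longrightarrow> member y s"
proof (rule ccontr)
  assume P: "(x, y) \<in> P" and x: "member x s" and y: "\<not> member y s"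
  obtain T where T: "(x, True) \<in> set (stage s T)" using x member_iff by blast
  obtain b T' where "(y, b) \<in> set (stage s T')" using stage_covers_Least by blast
  then have "(y, False) \<in> set (stage s T')" using y member_iff by (cases b) auto
  then have "(x, y) \<notin> P"
    using T stage_mono[of T "max T T'" s] stage_mono[of T' "max T T'" s]
    by (intro stage_consistent[of x s "max T T'" y]) auto
  with P show False by simp
qed

lemma member_separates:
  assumes "(x, y) \<notin> P" shows "\<exists>s. member x s \<and> \<not> member y s"
proof -
  have "prod_encode (x, y) \<in> range h" using assms unfolding h_range by blast
  then obtain s where "h s = prod_encode (x, y)" by force
  then have "(x, True) \<in> set (stage s 0)" "(y, False) \<in> set (stage s 0)" by (simp_all add: stage_0)
  then show ?thesis using member_iff not_both by metis
qed

lemma compu_stage: "compu f \<Longrightarrow> compu g \<Longrightarrow> compu (\<lambda>x. stage (f x) (g x))"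
proof -
  note h = compu_compose[OF h_compu]
  have "compu (\<lambda>p. stage (fst p) (snd p))"
    unfolding stage_def safe_in_def safe_out_def refuted_def by (intro compu_intros h)
  from compu_compose[OF this, of "\<lambda>x. (f x, g x)"] show "compu f \<Longrightarrow> compu g \<Longrightarrow> ?thesis"
    by (simp add: compu_Pair)
qed

lemma compu_member: "compu (\<lambda>p. member (fst p) (snd p))"
proof -
  define t where "t n = (LEAST T. fst (prod_decode n) + 3 \<le> length (stage (snd (prod_decode n)) T))" for n
  have "\<exists>T. fst (prod_decode n) + 3 \<le> length (stage (snd (prod_decode n)) T)" for n
    using stage_unbounded[of "Suc (fst (prod_decode n))"] by (simp add: eval_nat_numeral)
  then have t: "compu t" unfolding t_def by (intro compu_intros compu_stage)
  have "member x s \<longleftrightarrow> \<not> list_all (\<lambda>p. p \<noteq> (x, True)) (stage s (t (prod_encode (x, s))))" for x s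
    by (auto simp: member_def t_def list_all_iff)
  then show ?thesis
    by (simp only:) (intro compu_intros compu_stage compu_compose[OF t])
qed

end

lemma Pi01_preorder_as_family:
  assumes "Pi01_preorder P"
  shows "\<exists>u. compu (\<lambda>p :: nat \<times> nat. u (fst p) (snd p)) \<and>
    (\<forall>x y. (x, y) \<in> P \<longleftrightarrow> (\<forall>s. u x s \<longrightarrow> u y s))"
proof (cases "P = UNIV")
  case True
  \<comment> \<open>An empty complement has no enumerating function; a constant family represents
    the full relation.\<close>
  then show ?thesis by (intro exI[of _ "\<lambda>_ _. True"]) (auto intro: compu_const)
next
  case False
  then have "prod_encode ` (- P) \<noteq> {}" by auto
  moreover have "rec_enumerable (prod_encode ` (- P))"
    using assms by (simp add: Pi01_preorder_def Pi01_def)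
  ultimately obtain h where "computable h" "range h = prod_encode ` (- P)"
    unfolding rec_enumerable_def by metis
  moreover have "\<And>x. (x, x) \<in> P" "\<And>x y z. (x, y) \<in> P \<Longrightarrow> (y, z) \<in> P \<Longrightarrow> (x, z) \<in> P"
    using assms by (auto simp: Pi01_preorder_def preorder_on_def refl_on_def elim: transE)
  ultimately interpret pi01_preorder P h
    by unfold_locales (auto simp: compu_iff_computable)
  show ?thesis using compu_member member_upward member_separates by blast
qed

theorem theorem5p5:
  "Pi01_preorder {(i, j). ptime_set i \<subseteq> ptime_set j} \<and>
   (\<forall>P :: (nat \<times> nat) set. Pi01_preorder P \<longrightarrow>
     (\<exists>f :: nat \<Rightarrow> nat. computable f \<and>
       (\<forall>x y. (x, y) \<in> P \<longleftrightarrow> ptime_set (f x) \<subseteq> ptime_set (f y))))"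
proof (intro conjI allI impI)
  fix P :: "(nat \<times> nat) set"
  assume "Pi01_preorder P"
  then obtain u where u: "compu (\<lambda>p :: nat \<times> nat. u (fst p) (snd p))"
    "\<forall>x y. (x, y) \<in> P \<longleftrightarrow> (\<forall>s. u x s \<longrightarrow> u y s)"
    using Pi01_preorder_as_family by blast
  obtain f where "compu f" "\<forall>x y. ptime_set (f x) \<subseteq> ptime_set (f y) \<longleftrightarrow> (\<forall>s. u x s \<longrightarrow> u y s)"
    using ptime_subset_family[OF u(1)] by blast
  with u(2) show "\<exists>f :: nat \<Rightarrow> nat. computable f \<and> (\<forall>x y. (x, y) \<in> P \<longleftrightarrow> ptime_set (f x) \<subseteq> ptime_set (f y))"
    by (intro exI[of _ f]) (simp add: compu_iff_computable)
qed (rule Pi01_preorder_ptime_subset)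

end
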